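(* Let $p$ be a prime, $e,n\ge1$, $r=2en$, $q=p^r$, and let $s>1$ be a divisor of $p^e+1$. Let $h\in\{0,\dots,s-1\}$, $m\ge2$, $a\in\mathbb{F}_q$, $t\mid m$, $d=\gcd(m/t,s)$, $l=\gcd(t,s/d)$, $u=s/(dl)$, $t_0=\frac{q^t-1}{q-1}$, and assume $p\nmid m/t$ and $d\mid h$. Let $i_0$ be the unique integer with $0\le i_0<s/d$ and $\frac{m}{dt}i_0\equiv\frac hd\pmod{s/d}$. (A) If $a=0$: when $l>1$ and $i_0\not\equiv k_l(t)\pmod l$, $N_t=\frac ds\bigl(q^{t-1}-1+(-1)^{nt}(q-1)\sqrt{q^{t-2}}\bigr)$; when $l=1$, or $l>1$ and $i_0\equiv k_l(t)\pmod l$, $N_t=\frac ds\bigl(q^{t-1}-1-(-1)^{nt}(q-1)(l-1)\sqrt{q^{t-2}}\bigr)$. (B) If $a\neq0$, put $a_0=-\frac{m}{ta}$ and $D=k_{s/d}(t)-i_0-\mathrm{ind}_{\gamma_t}a_0$. When $l\nmid D$, $N_t=\frac ds\bigl(q^{t-1}-(-1)^{nt}\sqrt{q^{t-2}}\bigr)$. When $l\mid D$, let $j_0\in\{0,\dots,u-1\}$ be the unique solution of $\frac{t_0}{l}j\equiv\frac Dl\pmod u$; then if $u>1$ and $j_0\not\equiv k_u(1)\pmod u$, $N_t=\frac ds\bigl(q^{t-1}-(-1)^{nt}\bigl(((-1)^n\sqrt q-1)l+1\bigr)\sqrt{q^{t-2}}\bigr)$, while if $u=1$, or $u>1$ and $j_0\equiv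 k_u(1)\pmod u$, $N_t=\frac ds\bigl(q^{t-1}-(-1)^{nt}\bigl(((-1)^{n-1}(u-1)\sqrt q-1)l+1\bigr)\sqrt{q^{t-2}}\bigr)$. In particular, if $a=0$ and $l=1$ then $N_t=\frac ds(q^{t-1}-1)$, and if $a\ne0$ and $d=s$ then $N_t=q^{t-1}$.
   Context: $\mathrm{Tr}_k,\mathrm{Nm}_k$ are trace and norm $\mathbb{F}_{q^k}\to\mathbb{F}_q$. $\gamma_m$ is a fixed primitive element of $\mathbb{F}_{q^m}$, $\gamma_t$ its norm to $\mathbb{F}_{q^t}$ (primitive in $\mathbb{F}_{q^t}$), $g=\mathrm{Nm}_m(\gamma_m)$. $N_t$ is the number of $x\in\mathbb{F}_{q^t}$ with $\mathrm{Tr}_m(x)=a$ and $\mathrm{Nm}_m(x)\in g^h\langle g^s\rangle$. $\mathrm{ind}_{\gamma_t}a_0$ is the discrete logarithm of $a_0\in\mathbb{F}_q^*\subseteq\mathbb{F}_{q^t}^*$ to base $\gamma_t$. For a positive divisor $N$ of $p^e+1$ and an integer $t'\ge1$, define $k_N(t')=N/2$ if $p>2$, $nt'$ is odd and $(p^e+1)/N$ is odd, and $k_N(t')=0$ otherwise. *)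

theory Defs
  imports Complex_Main "HOL-Library.Cardinality" "HOL-Number_Theory.Cong"
begin

text \<open>
  A field of order \<open>q ^ m\<close> is a type \<open>'a :: {field, finite}\<close> with \<open>CARD('a) = q ^ m\<close>.  Its
  subfields are subsets of \<open>'a\<close>: for \<open>t dvd m\<close> the unique subfield of order \<open>q ^ t\<close>
  is \<open>GFsub (q ^ t)\<close>.
\<close>

definition GFsub :: "nat \<Rightarrow> 'a::{field,finite} set" where
  "GFsub Q = {x. x ^ Q = x}"

text \<open>
  Trace and norm of the extension of degree \<open>k\<close> of the field of order \<open>Q\<close>: sum and product of the
  conjugates of \<open>x\<close> under the Frobenius automorphism \<open>x \<mapsto> x ^ Q\<close>, which generates the Galois group.
\<close>

definition gf_trace :: "nat \<Rightarrow> nat \<Rightarrow> 'a::{field,finite} \<Rightarrow> 'a" where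
  "gf_trace Q k x = (\<Sum>i<k. x ^ (Q ^ i))"

definition gf_norm :: "nat \<Rightarrow> nat \<Rightarrow> 'a::{field,finite} \<Rightarrow> 'a" where
  "gf_norm Q k x = (\<Prod>i<k. x ^ (Q ^ i))"

definition cyclic_subgroup :: "'a::{field,finite} \<Rightarrow> 'a set" where
  "cyclic_subgroup z = range (\<lambda>k::int. z powi k)"

definition primitive_element :: "'a::{field,finite} \<Rightarrow> bool" where
  "primitive_element z \<longleftrightarrow> z \<noteq> 0 \<and> cyclic_subgroup z = UNIV - {0}"

text \<open>The discrete logarithm is normalised to the least nonnegative exponent.\<close>

definition dlog :: "'a::{field,finite} \<Rightarrow> 'a \<Rightarrow> nat" where
  "dlog b x = (LEAST k. b ^ k = x)"

text \<open>
  Used for positive divisors \<open>N\<close> of \<open>p ^ e + 1\<close> only.  Then both divisions are exact: if \<open>p\<close> is odd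
  and \<open>(p ^ e + 1) div N\<close> is odd, \<open>N\<close> is even.
\<close>

definition kshift :: "nat \<Rightarrow> nat \<Rightarrow> nat \<Rightarrow> nat \<Rightarrow> nat \<Rightarrow> nat" where
  "kshift p e n N t =
     (if p > 2 \<and> odd (n * t) \<and> odd ((p ^ e + 1) div N) then N div 2 else 0)"

text \<open>
  Trace and norm are taken from the field of order \<open>q ^ m\<close> to the field of order \<open>q\<close>, although \<open>x\<close>
  ranges over the field of order \<open>q ^ t\<close> only.
\<close>

definition trace_norm_count ::
  "nat \<Rightarrow> nat \<Rightarrow> nat \<Rightarrow> nat \<Rightarrow> nat \<Rightarrow> 'a::{field,finite} \<Rightarrow> 'a \<Rightarrow> nat" where
  "trace_norm_count q m t s h g a =
     card {x \<in> GFsub (q ^ t). gf_trace q m x = a \<and>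
             gf_norm q m x \<in> (\<lambda>y. g ^ h * y) ` cyclic_subgroup (g ^ s)}"

end

theory Submission
  imports Defs "HOL-Computational_Algebra.Primes" "HOL-Computational_Algebra.Polynomial"
begin

text \<open>
  Writing \<open>x = \<gamma>t ^ i\<close>, the norm condition says that \<open>i\<close> is congruent to \<open>i0\<close> modulo \<open>S = s div d\<close>, so one
  counts the elements of prescribed trace in a coset of the \<open>S\<close>-th powers.  Additive characters of
  the small field express this count through Gaussian periods of order \<open>S\<close> of the large field and,
  if the trace is nonzero, one Gaussian period of order \<open>u\<close> of the small field.

  All these orders divide \<open>w + 1\<close> with \<open>w = p ^ e\<close>, so the periods are explicit.  It suffices to treat
  the order \<open>w + 1\<close>.  There the period \<open>\<eta>\<close> is an integer, and \<open>1 + (w + 1) * \<eta>\<close> is the exponential sum of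
  the Hermitian form \<open>c * x ^ (w + 1)\<close>, whose square is the size of the field times the number of
  solutions of \<open>c * z + c ^ w * z ^ (w * w) = 0\<close>.  This determines the sum up to its sign, and the sign
  follows because the sum is congruent to \<open>1\<close> modulo \<open>w + 1 > 2\<close>, where \<open>w\<close> is congruent to \<open>-1\<close>.
\<close>

section \<open>Subfields and additive characters\<close>

lemma prime_CHAR_finite_field: "prime CHAR('a::{field,finite})"
  using finite_imp_CHAR_pos[where 'a='a] prime_CHAR_semidom[where ?'a='a] by simp

lemma card_GFsub_le:
  assumes "Q > 1"
  shows "card (GFsub Q :: 'a::{field,finite} set) \<le> Q"
proof -
  let ?P = "monom 1 Q - monom 1 1 :: 'a poly"
  have "coeff ?P Q = 1" using assms by simp
  hence nz: "?P \<noteq> 0" by (metis coeff_0 zero_neq_one)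
  have "GFsub Q = {x::'a. poly ?P x = 0}" by (auto simp: GFsub_def poly_monom)
  moreover have "degree ?P \<le> Q"
    using assms by (intro degree_diff_le degree_monom_le[THEN order_trans]) auto
  ultimately show ?thesis using card_poly_roots_bound[OF nz] by simp
qed

section \<open>Frobenius powers and closure properties of the subfields\<close>

lemma power_Frobenius_add:
  fixes x y :: "'a::{field,finite}"
  shows "(x + y) ^ (CHAR('a) ^ i) = x ^ (CHAR('a) ^ i) + y ^ (CHAR('a) ^ i)"
  by (rule freshmans_dream'[OF prime_CHAR_finite_field refl])

lemma power_Frobenius_sum:
  fixes f :: "'b \<Rightarrow> 'a::{field,finite}"
  shows "(\<Sum>x\<in>A. f x) ^ (CHAR('a) ^ i) = (\<Sum>x\<in>A. f x ^ (CHAR('a) ^ i))"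
  by (rule freshmans_dream_sum'[OF prime_CHAR_finite_field refl])

lemma of_nat_in_GFsub: "of_nat c \<in> (GFsub (CHAR('a) ^ i) :: 'a::{field,finite} set)"
  using power_Frobenius_sum[of "\<lambda>_. 1" "{..<c}" i] by (simp add: GFsub_def)

text \<open>The prime field: the \<open>CHAR('a)\<close> multiples of \<open>1\<close> are distinct
  and fixed by Frobenius, so they exhaust its fixed points. Trace values thus become natural numbers
  below the characteristic.\<close>

lemma GFsub_CHAR: "GFsub CHAR('a) = (of_nat ` {..<CHAR('a)} :: 'a::{field,finite} set)"
proof -
  have "inj_on (of_nat :: nat \<Rightarrow> 'a) {..<CHAR('a)}"
    by (auto simp: inj_on_def of_nat_eq_iff_cong_CHAR cong_def)
  hence "card (of_nat ` {..<CHAR('a)} :: 'a set) = CHAR('a)" by (simp add: card_image)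
  moreover have "of_nat ` {..<CHAR('a)} \<subseteq> (GFsub CHAR('a) :: 'a set)"
    using of_nat_in_GFsub[where 'a='a and i=1] by auto
  moreover have "card (GFsub CHAR('a) :: 'a set) \<le> CHAR('a)"
    by (rule card_GFsub_le) (rule prime_gt_1_nat[OF prime_CHAR_finite_field])
  ultimately show ?thesis by (intro card_seteq[symmetric]) auto
qed

lemma power_GFsub: "x \<in> GFsub Q \<Longrightarrow> x ^ (Q ^ i) = x"
  by (induction i) (auto simp: GFsub_def power_mult mult.commute)

lemma GFsub_power_subset: "GFsub Q \<subseteq> GFsub (Q ^ i)"
  by (auto simp: power_GFsub GFsub_def[of "Q ^ i"])

lemma GFsub_0: "Q > 0 \<Longrightarrow> 0 \<in> GFsub Q"
  by (simp add: GFsub_def)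

lemma GFsub_mult: "x \<in> GFsub Q \<Longrightarrow> y \<in> GFsub Q \<Longrightarrow> x * y \<in> GFsub Q"
  by (simp add: GFsub_def power_mult_distrib)

lemma GFsub_divide: "x \<in> GFsub Q \<Longrightarrow> y \<in> GFsub Q \<Longrightarrow> x / y \<in> GFsub Q"
  by (simp add: GFsub_def power_divide)

lemma GFsub_power: "x \<in> GFsub Q \<Longrightarrow> x ^ i \<in> GFsub Q"
  by (metis (mono_tags, lifting) GFsub_def mem_Collect_eq mult.commute power_mult)

lemma GFsub_add:
  "x \<in> GFsub (CHAR('a) ^ i) \<Longrightarrow> y \<in> GFsub (CHAR('a) ^ i) \<Longrightarrow>
   x + y \<in> (GFsub (CHAR('a) ^ i) :: 'a::{field,finite} set)"
  by (simp add: GFsub_def power_Frobenius_add)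

lemma GFsub_uminus:
  assumes "x \<in> GFsub (CHAR('a) ^ i)"
  shows "- x \<in> (GFsub (CHAR('a) ^ i) :: 'a::{field,finite} set)"
proof -
  \<comment> \<open>Additivity of Frobenius lets the sign pass through the power without a case
    split on the parity of \<open>CHAR('a)\<close>.\<close>
  have "(- x + x) ^ (CHAR('a) ^ i) = (- x) ^ (CHAR('a) ^ i) + x ^ (CHAR('a) ^ i)"
    by (rule power_Frobenius_add)
  thus ?thesis using assms prime_gt_0_nat[OF prime_CHAR_finite_field[where 'a='a]]
    by (simp add: GFsub_def eq_neg_iff_add_eq_0 power_0_left)
qed

section \<open>Trace and norm as power sums and power products\<close>

lemma gf_trace_add:
  "gf_trace (CHAR('a) ^ i) k (x + y :: 'a::{field,finite}) =
   gf_trace (CHAR('a) ^ i) k x + gf_trace (CHAR('a) ^ i) k y"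
  by (simp add: gf_trace_def power_Frobenius_add sum.distrib flip: power_mult)

lemma gf_trace_mult_left:
  "c \<in> GFsub Q \<Longrightarrow> gf_trace Q k (c * x) = c * gf_trace Q k x"
  by (simp add: gf_trace_def power_mult_distrib power_GFsub sum_distrib_left)

lemma gf_trace_GFsub: "x \<in> GFsub Q \<Longrightarrow> gf_trace Q k x = of_nat k * x"
  by (simp add: gf_trace_def power_GFsub)

text \<open>Raising to the power \<open>Q\<close> moves each conjugate to the next one, and the last
  one returns to \<open>x\<close> because \<open>x ^ (Q ^ k) = x\<close>.\<close>

lemma gf_trace_in_GFsub:
  fixes x :: "'a::{field,finite}"
  assumes "Q = CHAR('a) ^ i" "x \<in> GFsub (Q ^ k)"
  shows "gf_trace Q k x \<in> GFsub Q"
proof -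
  have "gf_trace Q k x ^ Q = (\<Sum>i<k. (x ^ (Q ^ i)) ^ Q)"
    unfolding gf_trace_def assms(1) by (rule power_Frobenius_sum)
  hence *: "gf_trace Q k x ^ Q = (\<Sum>i<k. x ^ (Q ^ Suc i))"
    by (simp add: mult.commute flip: power_mult)
  have "gf_trace Q k x ^ Q + x = (\<Sum>i<Suc k. x ^ (Q ^ i))"
    unfolding * sum.lessThan_Suc_shift[of _ k] by simp
  also have "\<dots> = gf_trace Q k x + x ^ (Q ^ k)" by (simp add: gf_trace_def)
  finally show ?thesis using assms(2) by (simp add: GFsub_def)
qed

text \<open>Transitivity of the trace: every index below \<open>t * k\<close> is
  \<open>i * k + j\<close> for unique \<open>i < t\<close> and \<open>j < k\<close>.\<close>

lemma gf_trace_mult_degree: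
  fixes x :: "'a::{field,finite}"
  assumes "Q = CHAR('a) ^ i"
  shows "gf_trace Q (t * k) x = gf_trace Q k (gf_trace (Q ^ k) t x)"
proof -
  have "gf_trace Q k (gf_trace (Q ^ k) t x) = (\<Sum>j<k. \<Sum>i<t. x ^ (Q ^ (i * k + j)))"
  proof -
    have *: "y ^ (Q ^ j) = y ^ (CHAR('a) ^ (i * j))" for y :: 'a and j
      by (simp add: assms power_mult)
    have "(x ^ ((Q ^ k) ^ i)) ^ (Q ^ j) = x ^ (Q ^ (i * k + j))" for i j
      by (simp add: power_add power_mult mult.commute[of i])
    thus ?thesis by (simp add: gf_trace_def * power_Frobenius_sum)
  qed
  also have "\<dots> = (\<Sum>i<t. \<Sum>j<k. x ^ (Q ^ (i * k + j)))" by (rule sum.swap)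
  also have "\<dots> = (\<Sum>i<t. \<Sum>j=i * k..<i * k + k. x ^ (Q ^ j))"
  proof -
    have "(\<Sum>j<k. x ^ (Q ^ (i * k + j))) = (\<Sum>j=i * k..<i * k + k. x ^ (Q ^ j))" for i
      using sum.shift_bounds_nat_ivl[of "\<lambda>j. x ^ (Q ^ j)" 0 "i * k" k]
      by (simp only: atLeast0LessThan add_0 add.commute)
    thus ?thesis by simp
  qed
  also have "\<dots> = gf_trace Q (t * k) x" by (simp add: gf_trace_def sum.nat_group)
  finally show ?thesis ..
qed

lemma gf_norm_eq_power: "gf_norm Q k x = x ^ (\<Sum>i<k. Q ^ i)"
  by (simp add: gf_norm_def power_sum)

text \<open>The canonical character of the field of order \<open>CHAR('a) ^ k\<close>. On that field
  the trace is a residue modulo \<open>CHAR('a)\<close>, and the choice of its representative does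
  not affect the value. The degree \<open>k\<close> is a parameter because characters of two
  subfields of one type occur.\<close>

definition add_char :: "nat \<Rightarrow> 'a::{field,finite} \<Rightarrow> complex" where
  "add_char k x =
     cis (2 * pi * real (SOME v. of_nat v = gf_trace CHAR('a) k x) / real CHAR('a))"

lemma cis_ne_1:
  assumes "0 < v" "v < p"
  shows "cis (2 * pi * real v / real p) \<noteq> 1"
proof
  assume "cis (2 * pi * real v / real p) = 1"
  hence "cos (2 * pi * real v / real p) = 1" by (metis cis.sel(1) one_complex.sel(1))
  then obtain z :: int where "2 * pi * real v / real p = of_int z * 2 * pi"
    by (auto simp: cos_one_2pi_int)
  hence "real v = of_int z * real p" using assms by (simp add: field_simps)
  hence "int v = z * int p" by (metis of_int_eq_iff of_int_mult of_int_of_nat_eq)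
  hence "p dvd v" by (metis dvd_triv_right int_dvd_int_iff)
  thus False using assms by (auto dest: dvd_imp_le)
qed

lemma cis_CHAR_cong:
  assumes "(of_nat v :: 'a::{field,finite}) = of_nat v'"
  shows "cis (2 * pi * real v / real CHAR('a)) = cis (2 * pi * real v' / real CHAR('a))"
proof -
  have *: "cis (2 * pi * real v / real CHAR('a)) = cis (2 * pi * real v' / real CHAR('a))"
    if "v = v' + c * CHAR('a)" for v v' c
  proof -
    have "2 * pi * real v / real CHAR('a) = 2 * pi * real v' / real CHAR('a) + 2 * pi * real c"
      using prime_gt_0_nat[OF prime_CHAR_finite_field[where 'a='a]] that
      by (simp add: field_simps)
    thus ?thesis by (simp add: cis_mult[symmetric] cis_multiple_2pi)
  qed
  have "[v = v'] (mod CHAR('a))" using assms by (simp add: of_nat_eq_iff_cong_CHAR)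
  then obtain c1 c2 where "v + c1 * CHAR('a) = v' + c2 * CHAR('a)"
    by (metis cong_iff_lin_nat mult.commute)
  then show ?thesis using *[of _ v c1] *[of _ v' c2] by metis
qed

lemma add_char_eq:
  assumes "gf_trace CHAR('a) k (x::'a::{field,finite}) = of_nat v"
  shows "add_char k x = cis (2 * pi * real v / real CHAR('a))"
proof -
  have "of_nat (SOME v. of_nat v = gf_trace CHAR('a) k x) = gf_trace CHAR('a) k x"
    by (rule someI[of "\<lambda>v. of_nat v = gf_trace CHAR('a) k x" v]) (simp add: assms)
  thus ?thesis unfolding add_char_def using assms by (intro cis_CHAR_cong) simp
qed

lemma norm_add_char [simp]: "norm (add_char k x) = 1"
  by (simp add: add_char_def)

text \<open>By transitivity of the trace down to the prime field, the character of the field of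
  order \<open>Q ^ t\<close> is that of the field of order \<open>Q\<close> applied to the relative
  trace. This links trace conditions over the small field with periods of the large one.\<close>

lemma add_char_trace:
  fixes x :: "'a::{field,finite}"
  assumes "Q = CHAR('a) ^ k"
  shows "add_char (k * t) x = add_char k (gf_trace Q t x)"
  using gf_trace_mult_degree[where Q="CHAR('a)" and i=1 and t=t and k=k and x=x] assms
  by (simp add: add_char_def mult.commute)

text \<open>One type carries both fields; the locale is used with \<open>g\<close> for the field of
  order \<open>q\<close> and with \<open>\<gamma>t\<close> for the field of order
  \<open>q ^ t\<close>. An element of exact order \<open>p ^ k - 1\<close> generates the nonzero
  elements of the subfield, so sums over the subfield become sums over exponents.\<close>

locale gf_subfield =
  fixes p k :: nat and b :: "'a::{field,finite}"
  assumes p: "p = CHAR('a)" and k: "k > 0" and order: "\<And>i. b ^ i = 1 \<longleftrightarrow> p ^ k - 1 dvd i"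
begin

abbreviation Q :: nat where "Q \<equiv> p ^ k"
abbreviation L :: "'a set" where "L \<equiv> GFsub Q"
abbreviation chi :: "'a \<Rightarrow> complex" where "chi \<equiv> add_char k"

lemma prime_p: "prime p"
  using prime_CHAR_finite_field[where 'a='a] by (simp add: p)

lemma Q_gt_1: "Q > 1"
  by (rule one_less_power[OF prime_gt_1_nat[OF prime_p] k])

lemma b_power_Q: "b ^ (Q - 1) = 1"
  by (simp add: order)

lemma b_nonzero: "b \<noteq> 0"
  using b_power_Q Q_gt_1 by (metis power_0_left zero_neq_one zero_less_diff less_numeral_extra(3))

lemma b_power_eq_iff: "b ^ i = b ^ j \<longleftrightarrow> [i = j] (mod Q - 1)"
proof (induction i j rule: linorder_wlog)
  case (le i j)
  have "b ^ i = b ^ j \<longleftrightarrow> b ^ (j - i) = 1"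
    using le b_nonzero by (auto simp: power_diff)
  thus ?case using le cong_altdef_nat[OF le, of "Q - 1"] by (metis cong_sym order)
next
  case (sym i j)
  thus ?case by (metis cong_sym)
qed

text \<open>The \<open>Q - 1\<close> distinct powers of \<open>b\<close> together with
  \<open>0\<close> are \<open>Q\<close> members, and \<open>card_GFsub_le\<close> allows no
  more.\<close>

lemma L_eq: "L = insert 0 ((\<lambda>i. b ^ i) ` {..<Q - 1})"
proof -
  have "inj_on (\<lambda>i. b ^ i) {..<Q - 1}"
    by (auto simp: inj_on_def b_power_eq_iff cong_def)
  hence "card (insert 0 ((\<lambda>i. b ^ i) ` {..<Q - 1})) = Q"
    using b_nonzero Q_gt_1 by (subst card_insert_disjoint) (auto simp: card_image)
  moreover have "insert 0 ((\<lambda>i. b ^ i) ` {..<Q - 1}) \<subseteq> L"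
  proof -
    have "b ^ Q = b" using b_power_Q Q_gt_1
      by (metis One_nat_def Suc_pred less_trans mult.right_neutral power_Suc zero_less_one)
    hence "b ^ i \<in> L" for i using GFsub_power[of b Q i] by (simp add: GFsub_def)
    moreover have "0 \<in> L" by (rule GFsub_0) (use Q_gt_1 in linarith)
    ultimately show ?thesis by auto
  qed
  ultimately show ?thesis using card_GFsub_le[OF Q_gt_1, where 'a='a]
    by (intro card_seteq[symmetric]) auto
qed

lemma card_L: "card L = Q"
proof -
  have "inj_on (\<lambda>i. b ^ i) {..<Q - 1}"
    by (auto simp: inj_on_def b_power_eq_iff cong_def)
  thus ?thesis
    using b_nonzero Q_gt_1 unfolding L_eq by (subst card_insert_disjoint) (auto simp: card_image)
qed

lemma b_in_L: "b ^ i \<in> L"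
proof -
  have "b ^ i = b ^ (i mod (Q - 1))" by (simp add: b_power_eq_iff)
  moreover have "i mod (Q - 1) < Q - 1" using Q_gt_1 by simp
  ultimately show ?thesis unfolding L_eq by blast
qed

lemma L_nonzeroE:
  assumes "x \<in> L" "x \<noteq> 0"
  obtains i where "i < Q - 1" "x = b ^ i"
  using assms unfolding L_eq by auto

lemma sum_L: "(\<Sum>x\<in>L. f x) = f 0 + (\<Sum>i<Q - 1. f (b ^ i))"
proof -
  have "inj_on (\<lambda>i. b ^ i) {..<Q - 1}"
    by (auto simp: inj_on_def b_power_eq_iff cong_def)
  thus ?thesis
    using b_nonzero unfolding L_eq by (subst sum.insert) (auto simp: sum.reindex)
qed

lemma trace_L:
  assumes "x \<in> L"
  shows "\<exists>v<p. gf_trace p k x = of_nat v"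
proof -
  have "gf_trace p k x \<in> GFsub p"
    using assms by (intro gf_trace_in_GFsub[of _ 1]) (auto simp: p)
  thus ?thesis using GFsub_CHAR[where 'a='a] by (auto simp: p)
qed

lemma chi_add:
  assumes "x \<in> L" "y \<in> L"
  shows "chi (x + y) = chi x * chi y"
proof -
  obtain v w where v: "gf_trace p k x = of_nat v" and w: "gf_trace p k y = of_nat w"
    using trace_L assms by metis
  have "gf_trace p k (x + y) = of_nat (v + w)"
    using gf_trace_add[where 'a='a and i=1] v w by (simp add: p)
  hence "chi (x + y) = cis (2 * pi * real (v + w) / real p)"
    unfolding p by (rule add_char_eq)
  also have "\<dots> = cis (2 * pi * real v / real p) * cis (2 * pi * real w / real p)"
    by (simp add: cis_mult add_divide_distrib ring_distribs)
  also have "cis (2 * pi * real v / real p) = chi x"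
    using v unfolding p by (rule add_char_eq[symmetric])
  also have "cis (2 * pi * real w / real p) = chi y"
    using w unfolding p by (rule add_char_eq[symmetric])
  finally show ?thesis .
qed

lemma chi_0: "chi 0 = 1"
proof -
  have "0 \<in> L" by (rule GFsub_0) (use Q_gt_1 in linarith)
  hence "chi 0 * chi 0 = chi 0" using chi_add[of 0 0] by simp
  moreover have "chi 0 \<noteq> 0" using norm_add_char[of k "0::'a"] by (metis norm_zero zero_neq_one)
  ultimately show ?thesis by simp
qed

text \<open>The trace of \<open>x ^ p\<close> is the \<open>p\<close>-th power of the trace of
  \<open>x\<close>, which is fixed since it lies in the prime field.\<close>

lemma chi_Frobenius:
  assumes "x \<in> L"
  shows "chi (x ^ (p ^ i)) = chi x"
proof (induction i)
  case (Suc i)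
  let ?y = "x ^ (p ^ i)"
  have y: "?y \<in> L" using assms by (rule GFsub_power)
  have "gf_trace p k (?y ^ p) = gf_trace p k ?y ^ p"
    unfolding gf_trace_def p power_Frobenius_sum[where i=1, simplified]
    by (intro sum.cong refl) (metis power_mult mult.commute)
  also have "\<dots> = gf_trace p k ?y"
    using gf_trace_in_GFsub[of p 1 ?y k] y by (simp add: p GFsub_def)
  finally have "chi (?y ^ p) = chi ?y" by (simp add: add_char_def p)
  thus ?case using Suc by (simp add: mult.commute flip: power_mult)
qed simp

text \<open>As a polynomial the trace has degree at most \<open>p ^ (k - 1) < Q\<close> and
  coefficient \<open>1\<close> at \<open>X\<close>, so it cannot vanish on all \<open>Q\<close>
  elements of \<open>L\<close>; a nonzero trace gives a root of unity other than
  \<open>1\<close>.\<close>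

lemma chi_nontrivial: "\<exists>x\<in>L. chi x \<noteq> 1"
proof -
  have p1: "p > 1" by (rule prime_gt_1_nat[OF prime_p])
  let ?P = "\<Sum>i<k. monom 1 (p ^ i) :: 'a poly"
  have "coeff ?P 1 = (\<Sum>i<k. if i = 0 then 1 else 0)"
    unfolding coeff_sum using p1 by (intro sum.cong) auto
  also have "\<dots> = 1" using k by simp
  finally have nz: "?P \<noteq> 0" by (metis coeff_0 zero_neq_one)
  have "degree ?P \<le> p ^ (k - 1)"
  proof (intro degree_sum_le)
    fix i assume "i \<in> {..<k}"
    hence "p ^ i \<le> p ^ (k - 1)" using p1 by (intro power_increasing) auto
    thus "degree (monom (1::'a) (p ^ i)) \<le> p ^ (k - 1)"
      using degree_monom_le order_trans by blast
  qed simp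
  also have "\<dots> < Q" using p1 k by (intro power_strict_increasing) auto
  finally have "card {x. poly ?P x = 0} < card L"
    using card_poly_roots_bound[OF nz] by (simp add: card_L)
  hence "\<not> L \<subseteq> {x. poly ?P x = 0}" by (metis card_mono finite_code linorder_not_less)
  then obtain x where x: "x \<in> L" "gf_trace p k x \<noteq> 0"
    by (auto simp: poly_sum poly_monom gf_trace_def)
  then obtain v where v: "gf_trace p k x = of_nat v" "v < p" using trace_L by blast
  have "v > 0" using x v by (cases v) auto
  have "chi x = cis (2 * pi * real v / real p)" using add_char_eq v by (simp add: p)
  moreover have "cis (2 * pi * real v / real p) \<noteq> 1"
    by (rule cis_ne_1) (fact \<open>v > 0\<close> v(2))+
  ultimately have "chi x \<noteq> 1" by simp
  thus ?thesis using x(1) by blast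
qed

text \<open>Translation by some \<open>y\<close> with \<open>chi y \<noteq> 1\<close> permutes
  \<open>L\<close> and multiplies the sum by \<open>chi y\<close>.\<close>

lemma sum_chi: "(\<Sum>x\<in>L. chi x) = 0"
proof -
  obtain y where y: "y \<in> L" "chi y \<noteq> 1" using chi_nontrivial by blast
  have my: "- y \<in> L" using y GFsub_uminus by (auto simp: p)
  have "(\<Sum>x\<in>L. chi x) = (\<Sum>x\<in>L. chi (y + x))"
    by (rule sum.reindex_bij_witness[of _ "\<lambda>x. y + x" "\<lambda>x. - y + x"])
       (use y my GFsub_add[where 'a='a and i=k] GFsub_add[of _ k "- y"] in \<open>auto simp: p\<close>)
  also have "\<dots> = chi y * (\<Sum>x\<in>L. chi x)" using y by (simp add: chi_add sum_distrib_left)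
  finally show ?thesis using y(2) by (metis mult_cancel_right mult_1)
qed

lemma sum_L_mult:
  assumes "c \<in> L" "c \<noteq> 0"
  shows "(\<Sum>x\<in>L. f (c * x)) = (\<Sum>x\<in>L. f x)"
  by (rule sum.reindex_bij_witness[of _ "\<lambda>x. x / c" "\<lambda>x. c * x"])
     (use assms in \<open>auto simp: GFsub_mult GFsub_divide\<close>)

text \<open>Orthogonality: it turns the equation \<open>c = 0\<close> into a character sum, both for
  the trace condition and for the radical of the Hermitian form.\<close>

lemma sum_chi_mult:
  assumes "c \<in> L"
  shows "(\<Sum>x\<in>L. chi (c * x)) = (if c = 0 then of_nat Q else 0)"
  using sum_L_mult[OF assms, of chi] by (auto simp: sum_chi chi_0 card_L)

lemma sum_L_Frobenius: "(\<Sum>x\<in>L. f (x ^ (p ^ i))) = (\<Sum>x\<in>L. f x)"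
proof -
  have inj: "inj_on (\<lambda>x::'a. x ^ (p ^ i)) L"
  proof (rule inj_onI)
    fix x y :: 'a assume "x ^ (p ^ i) = y ^ (p ^ i)"
    moreover have "x ^ (p ^ i) = (x - y) ^ (p ^ i) + y ^ (p ^ i)"
      using power_Frobenius_add[of "x - y" y i] by (simp add: p)
    ultimately show "x = y" by simp
  qed
  have "(\<lambda>x. x ^ (p ^ i)) ` L = L"
    by (rule card_subset_eq) (auto simp: GFsub_power card_image[OF inj])
  with inj show ?thesis by (metis (no_types, lifting) sum.reindex_cong)
qed

end

section \<open>Gaussian periods\<close>

lemma sum_blocks:
  fixes f :: "nat \<Rightarrow> 'b::comm_monoid_add"
  shows "(\<Sum>i<A * B. f i) = (\<Sum>m<A. \<Sum>i<B. f (m * B + i))"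
proof -
  have "(\<Sum>i<B. f (m * B + i)) = (\<Sum>i=m * B..<m * B + B. f i)" for m
    using sum.shift_bounds_nat_ivl[of f 0 "m * B" B]
    by (simp only: atLeast0LessThan add_0 add.commute)
  thus ?thesis by (simp add: sum.nat_group)
qed

lemma sum_residue_class:
  fixes f :: "nat \<Rightarrow> 'b::comm_monoid_add"
  assumes "c < u"
  shows "(\<Sum>j | j < u * K \<and> [j = c] (mod u). f j) = (\<Sum>i<K. f (c + u * i))"
proof -
  have "c + u * i < u * K" if "i < K" for i
  proof -
    have "c + u * i < u * Suc i" using assms by simp
    also have "\<dots> \<le> u * K" using that by (intro mult_le_mono2) simp
    finally show ?thesis .
  qed
  thus ?thesis
    by (intro sum.reindex_bij_witness[of _ "\<lambda>i. c + u * i" "\<lambda>j. j div u"])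
       (use assms in \<open>auto simp: cong_def less_mult_imp_div_less mult.commute\<close>)
qed

text \<open>Coefficient and modulus are both divisible by \<open>B\<close>; cancelling it leaves one
  class modulo \<open>A\<close>. The right side is an integer because it will be a difference of
  exponents.\<close>

lemma cong_int_mult_iff_ex1:
  fixes A B :: nat and z :: int
  assumes "A > 0" "B > 0"
  shows "(\<exists>x. [int B * int x = z] (mod int (A * B))) \<longleftrightarrow> int B dvd z"
    and "int B dvd z \<Longrightarrow> \<exists>x0<A. \<forall>x. [int B * int x = z] (mod int (A * B)) \<longleftrightarrow> [x = x0] (mod A)"
proof -
  have *: "\<exists>x0<A. \<forall>x. [int B * int x = z] (mod int (A * B)) \<longleftrightarrow> [x = x0] (mod A)"
    if dz: "int B dvd z"
  proof -
    obtain y where y: "z = int B * y" using dz by (elim dvdE)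
    define x0 where "x0 = nat (y mod int A)"
    have x0: "int x0 = y mod int A" using assms by (simp add: x0_def)
    have "x0 < A" using assms by (simp add: x0_def nat_less_iff)
    moreover have "[int B * int x = z] (mod int (A * B)) \<longleftrightarrow> [x = x0] (mod A)" for x
    proof -
      have "[int B * int x = z] (mod int (A * B)) \<longleftrightarrow> int B * int A dvd int B * (int x - y)"
        by (simp add: cong_iff_dvd_diff y algebra_simps)
      also have "\<dots> \<longleftrightarrow> int A dvd int x - y" using assms by simp
      also have "\<dots> \<longleftrightarrow> [int x = int x0] (mod int A)"
        unfolding x0 by (simp add: cong_iff_dvd_diff[symmetric] cong_def)
      also have "\<dots> \<longleftrightarrow> [x = x0] (mod A)" by (simp add: cong_int_iff)
      finally show ?thesis .
    qed
    ultimately show ?thesis by blast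
  qed
  show "int B dvd z \<Longrightarrow> \<exists>x0<A. \<forall>x. [int B * int x = z] (mod int (A * B)) \<longleftrightarrow> [x = x0] (mod A)"
    by (rule *)
  show "(\<exists>x. [int B * int x = z] (mod int (A * B))) \<longleftrightarrow> int B dvd z"
  proof
    assume "\<exists>x. [int B * int x = z] (mod int (A * B))"
    then obtain x where "[int B * int x = z] (mod int (A * B))" by blast
    hence "[int B * int x = z] (mod int B)"
      by (rule cong_dvd_modulus) simp
    thus "int B dvd z" by (metis cong_dvd_iff dvd_triv_left)
  next
    assume "int B dvd z"
    thus "\<exists>x. [int B * int x = z] (mod int (A * B))" using * cong_refl by blast
  qed
qed

lemma sum_cis_roots:
  assumes "p > 1"
  shows "(\<Sum>v<p. cis (2 * pi * real v / real p)) = 0"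
proof -
  let ?w = "cis (2 * pi / real p)"
  have "cis (2 * pi * real v / real p) = ?w ^ v" for v
    by (simp add: DeMoivre mult_ac)
  moreover have "?w \<noteq> 1" using cis_ne_1[of 1 p] assms by simp
  moreover have "?w ^ p = 1" using assms by (simp add: DeMoivre)
  ultimately show ?thesis by (simp add: sum_gp_strict)
qed

section \<open>Gaussian periods: cosets, integrality and power sums\<close>

context gf_subfield
begin

text \<open>For \<open>N\<close> dividing \<open>Q - 1\<close> the index \<open>i\<close> runs once
  through the coset of \<open>b ^ j\<close> modulo the nonzero \<open>N\<close>-th powers of
  \<open>L\<close>.\<close>

definition period :: "nat \<Rightarrow> nat \<Rightarrow> complex" where
  "period N j = (\<Sum>i<(Q - 1) div N. chi (b ^ (j + N * i)))"

text \<open>Equality of powers is a linear congruence in \<open>i\<close> with a solution unique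
  modulo \<open>(Q - 1) div N\<close>, which gives injectivity and surjectivity together. The image
  is described by exponents modulo \<open>N\<close>, free of the enumeration.\<close>

lemma period_reindex:
  assumes "N dvd Q - 1"
  shows "inj_on (\<lambda>i. b ^ (j + N * i)) {..<(Q - 1) div N}"
    and "(\<lambda>i. b ^ (j + N * i)) ` {..<(Q - 1) div N} = {b ^ i |i. [i = j] (mod N)}"
proof -
  obtain K where K: "Q - 1 = K * N" using assms by (metis dvdE mult.commute)
  have NK: "N > 0" "K > 0" using K Q_gt_1 by (auto intro!: Nat.gr0I)
  have KN: "(Q - 1) div N = K" using K NK by simp
  have eq: "b ^ (j + N * i) = b ^ i' \<longleftrightarrow> [int N * int i = int i' - int j] (mod int (K * N))" for i i'
  proof -
    have "b ^ (j + N * i) = b ^ i' \<longleftrightarrow> [int (j + N * i) = int i'] (mod int (K * N))"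
      by (simp only: b_power_eq_iff K cong_int_iff)
    thus ?thesis by (simp add: cong_iff_dvd_diff algebra_simps)
  qed
  have dvd: "int N dvd int i' - int j \<longleftrightarrow> [i' = j] (mod N)" for i'
    by (simp add: cong_iff_dvd_diff[symmetric] cong_int_iff)
  show "inj_on (\<lambda>i. b ^ (j + N * i)) {..<(Q - 1) div N}"
  proof (rule inj_onI)
    fix i i' assume *: "i \<in> {..<(Q - 1) div N}" "i' \<in> {..<(Q - 1) div N}"
      "b ^ (j + N * i) = b ^ (j + N * i')"
    have "int N dvd int (j + N * i') - int j" by simp
    then obtain x0 where "\<forall>x. b ^ (j + N * x) = b ^ (j + N * i') \<longleftrightarrow> [x = x0] (mod K)"
      using cong_int_mult_iff_ex1(2)[OF NK(2,1)] unfolding eq by blast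
    hence "[i = i'] (mod K)" using *(3) by (metis cong_sym cong_trans)
    thus "i = i'" using * KN cong_less_modulus_unique_nat by simp
  qed
  show "(\<lambda>i. b ^ (j + N * i)) ` {..<(Q - 1) div N} = {b ^ i |i. [i = j] (mod N)}"
  proof (intro equalityI subsetI)
    fix x assume "x \<in> {b ^ i |i. [i = j] (mod N)}"
    then obtain i where i: "x = b ^ i" "[i = j] (mod N)" by blast
    then obtain x0 where x0: "x0 < K"
      "\<forall>x. b ^ (j + N * x) = b ^ i \<longleftrightarrow> [x = x0] (mod K)"
      using cong_int_mult_iff_ex1(2)[OF NK(2,1)] unfolding eq dvd[symmetric] by blast
    have "x = b ^ (j + N * x0)" by (metis cong_refl i(1) x0(2))
    thus "x \<in> (\<lambda>i. b ^ (j + N * i)) ` {..<(Q - 1) div N}" using x0(1) KN by blast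
  qed (auto simp: cong_def)
qed

lemma period_eq_sum:
  "N dvd Q - 1 \<Longrightarrow> period N j = (\<Sum>x\<in>{b ^ i |i. [i = j] (mod N)}. chi x)"
  unfolding period_def
  by (subst period_reindex(2)[symmetric], assumption)
     (simp only: sum.reindex[OF period_reindex(1)] o_def)

text \<open>The coset is stable under multiplication by the prime field, so the nonzero values of the
  trace are all taken equally often on it.\<close>

lemma period_in_Ints:
  assumes "N * (p - 1) dvd Q - 1"
  shows "period N j \<in> \<int>"
proof -
  have p1: "p > 1" by (rule prime_gt_1_nat[OF prime_p])
  have N: "N dvd Q - 1" using assms dvd_mult_left by blast
  define C where "C = {b ^ i |i. [i = j] (mod N)}"
  have finC: "finite C" by simp
  have CL: "C \<subseteq> L" using b_in_L by (auto simp: C_def)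
  define T :: "'a \<Rightarrow> 'a" where "T = gf_trace p k"
  define cnt where "cnt v = card {x \<in> C. T x = of_nat v}" for v :: nat
  have scal: "of_nat v * x \<in> C \<and> x / of_nat v \<in> C"
    if v: "0 < v" "v < p" and x: "x \<in> C" for v x
  proof -
    have v0: "(of_nat v :: 'a) \<noteq> 0"
      using v by (simp add: of_nat_eq_0_iff_char_dvd p[symmetric]) (auto dest: dvd_imp_le)
    have "of_nat v \<in> L" using of_nat_in_GFsub[where 'a='a] by (simp add: p)
    then obtain i where i: "of_nat v = b ^ i" using v0 by (metis L_nonzeroE)
    \<comment> \<open>Fermat's theorem and the divisibility of \<open>Q - 1\<close> by
      \<open>N * (p - 1)\<close> make every nonzero element of the prime field an
      \<open>N\<close>-th power.\<close>
    have "(of_nat v :: 'a) ^ p = of_nat v"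
      using of_nat_in_GFsub[where 'a='a and i=1] by (simp add: p GFsub_def)
    hence "(of_nat v :: 'a) ^ (p - 1) = 1"
      using v0 p1 by (metis (no_types, lifting) less_imp_le power_diff power_one_right divide_self)
    hence "Q - 1 dvd i * (p - 1)" by (simp only: i flip: power_mult order)
    hence "N * (p - 1) dvd i * (p - 1)" using assms dvd_trans by blast
    hence Ni: "N dvd i" using p1 by simp
    obtain i' where i': "x = b ^ i'" "[i' = j] (mod N)" using x by (auto simp: C_def)
    have "[i + i' = 0 + j] (mod N)" using Ni i'(2) by (intro cong_add) (simp_all add: cong_0_iff)
    hence 1: "of_nat v * x \<in> C" unfolding C_def i i'(1) by (auto simp flip: power_add)
    \<comment> \<open>Since \<open>b\<close> has order \<open>Q - 1\<close>,
      \<open>b ^ ((Q - 2) * i)\<close> is the inverse of \<open>b ^ i\<close>, so division also has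
      a natural exponent.\<close>
    have "[i' + (Q - 2) * i = j + 0] (mod N)"
      using Ni i'(2) by (intro cong_add) (simp_all add: cong_0_iff)
    moreover have "b ^ (i' + (Q - 2) * i) * b ^ i = b ^ i'"
    proof -
      have "Q - 1 = Suc (Q - 2)" using Q_gt_1 by linarith
      hence *: "(Q - 2) * i + i = (Q - 1) * i" by (simp only: mult_Suc add.commute)
      have "b ^ (i' + (Q - 2) * i) * b ^ i = b ^ (i' + ((Q - 2) * i + i))"
        by (simp only: power_add mult.assoc)
      also have "\<dots> = b ^ i' * (b ^ (Q - 1)) ^ i" by (simp only: * power_add power_mult)
      also have "\<dots> = b ^ i'" by (simp only: b_power_Q power_one mult_1_right)
      finally show ?thesis .
    qed
    hence "x / of_nat v = b ^ (i' + (Q - 2) * i)" using b_nonzero by (simp add: i i'(1) field_simps)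
    ultimately have "x / of_nat v \<in> C" unfolding C_def by auto
    with 1 show ?thesis ..
  qed
  have cnt: "cnt v = cnt 1" if v: "0 < v" "v < p" for v
  proof -
    have v0: "(of_nat v :: 'a) \<noteq> 0"
      using v by (simp add: of_nat_eq_0_iff_char_dvd p[symmetric]) (auto dest: dvd_imp_le)
    have T: "T (of_nat v * x) = of_nat v * T x" for x
      using gf_trace_mult_left[of "of_nat v" p k x] of_nat_in_GFsub[where 'a='a and i=1]
      by (simp add: p T_def)
    have T': "T (x / of_nat v) = T x / of_nat v" for x
      using T[of "x / of_nat v"] v0 by (simp add: field_simps)
    have "bij_betw (\<lambda>x. of_nat v * x) {x \<in> C. T x = of_nat 1} {x \<in> C. T x = of_nat v}"
    proof (rule bij_betw_byWitness[of _ "\<lambda>x. x / of_nat v"])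
      show "(\<lambda>x. of_nat v * x) ` {x \<in> C. T x = of_nat 1} \<subseteq> {x \<in> C. T x = of_nat v}"
        by (auto simp add: T scal[OF v, THEN conjunct1])
      show "(\<lambda>x. x / of_nat v) ` {x \<in> C. T x = of_nat v} \<subseteq> {x \<in> C. T x = of_nat 1}"
        by (auto simp add: T' v0 scal[OF v, THEN conjunct2])
    qed (simp_all add: v0)
    from bij_betw_same_card[OF this] show ?thesis by (simp only: cnt_def)
  qed
  have inj: "inj_on (of_nat :: nat \<Rightarrow> 'a) {..<p}"
    by (auto simp: inj_on_def of_nat_eq_iff_cong_CHAR cong_def p)
  have "T ` C \<subseteq> of_nat ` {..<p}" using trace_L CL by (fastforce simp: T_def)
  hence "(\<Sum>x\<in>C. chi x) = (\<Sum>y\<in>of_nat ` {..<p}. \<Sum>x | x \<in> C \<and> T x = y. chi x)"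
    using finC by (intro sum.group[symmetric]) auto
  also have "\<dots> = (\<Sum>v<p. \<Sum>x | x \<in> C \<and> T x = of_nat v. chi x)"
    using inj by (simp add: sum.reindex)
  also have "\<dots> = (\<Sum>v<p. of_nat (cnt v) * cis (2 * pi * real v / real p))"
  proof (intro sum.cong refl)
    fix v
    have "chi x = cis (2 * pi * real v / real p)" if "T x = of_nat v" for x
      using that unfolding T_def p by (rule add_char_eq)
    hence "(\<Sum>x | x \<in> C \<and> T x = of_nat v. chi x) =
        (\<Sum>x | x \<in> C \<and> T x = of_nat v. cis (2 * pi * real v / real p))"
      by (intro sum.cong) auto
    thus "(\<Sum>x | x \<in> C \<and> T x = of_nat v. chi x) = of_nat (cnt v) * cis (2 * pi * real v / real p)"
      by (simp only: sum_constant cnt_def)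
  qed
  \<comment> \<open>All nonzero values share the multiplicity \<open>cnt 1\<close>. The excess at
    \<open>0\<close> is split off, and what remains is a multiple of the vanishing sum of all
    \<open>p\<close>-th roots of unity.\<close>
  also have "\<dots> = (\<Sum>v<p. (if v = 0 then of_nat (cnt 0) - of_nat (cnt 1) else 0) +
      of_nat (cnt 1) * cis (2 * pi * real v / real p))"
  proof (intro sum.cong refl)
    fix v assume "v \<in> {..<p}"
    thus "of_nat (cnt v) * cis (2 * pi * real v / real p) =
        (if v = 0 then of_nat (cnt 0) - of_nat (cnt 1) else 0) +
        of_nat (cnt 1) * cis (2 * pi * real v / real p)"
      using cnt[of v] by (cases "v = 0") simp_all
  qed
  also have "\<dots> = of_nat (cnt 0) - of_nat (cnt 1)"
    using sum_cis_roots[OF p1] p1 by (simp add: sum.distrib flip: sum_distrib_left)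
  finally show ?thesis unfolding period_eq_sum[OF N] C_def[symmetric] by simp
qed

text \<open>A coset of the \<open>N\<close>-th powers is the disjoint union of \<open>A\<close>
  cosets of the powers of order \<open>N * A\<close>.\<close>

lemma period_mult:
  assumes "N * A dvd Q - 1" "A > 0"
  shows "period N j = (\<Sum>a<A. period (N * A) (j + N * a))"
proof -
  obtain K where K: "Q - 1 = N * A * K" using assms by (elim dvdE)
  hence NK: "N > 0" "K > 0" using Q_gt_1 by (auto intro!: Nat.gr0I)
  have d: "(Q - 1) div N = K * A" "(Q - 1) div (N * A) = K" using K NK assms(2) by auto
  have "period N j = (\<Sum>m<K. \<Sum>a<A. chi (b ^ (j + N * (m * A + a))))"
    unfolding period_def d by (rule sum_blocks)
  also have "\<dots> = (\<Sum>a<A. \<Sum>m<K. chi (b ^ (j + N * (m * A + a))))" by (rule sum.swap)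
  also have "\<dots> = (\<Sum>a<A. period (N * A) (j + N * a))"
    unfolding period_def d by (simp add: algebra_simps)
  finally show ?thesis .
qed

text \<open>The map \<open>x \<mapsto> x ^ M\<close> is \<open>M\<close> to one on the nonzero
  elements; the summand \<open>1\<close> comes from \<open>x = 0\<close>.\<close>

lemma sum_power_eq_period:
  assumes "M dvd Q - 1"
  shows "(\<Sum>x\<in>L. chi (b ^ j * x ^ M)) = 1 + of_nat M * period M j"
proof -
  obtain K where K: "Q - 1 = M * K" using assms by (elim dvdE)
  hence MK: "M > 0" "K > 0" using Q_gt_1 by (auto intro!: Nat.gr0I)
  have "(\<Sum>x\<in>L. chi (b ^ j * x ^ M)) = 1 + (\<Sum>i<M * K. chi (b ^ (j + M * i)))"
    using MK chi_0
    by (simp add: sum_L power_0_left K[symmetric] mult.commute[of _ M] del: One_nat_def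
        flip: power_mult power_add)
  also have "(\<Sum>i<M * K. chi (b ^ (j + M * i))) = (\<Sum>m<M. \<Sum>i<K. chi (b ^ (j + M * i)))"
  proof (subst sum_blocks, intro sum.cong refl)
    fix m i
    have "[j + M * (m * K + i) = j + M * i] (mod M * K)"
    proof -
      have "j + M * (m * K + i) = j + M * i + m * (M * K)" by (simp add: algebra_simps)
      thus ?thesis by (simp only: cong_def add.assoc[symmetric] mod_mult_self1)
    qed
    thus "chi (b ^ (j + M * (m * K + i))) = chi (b ^ (j + M * i))"
      by (metis b_power_eq_iff K)
  qed
  finally show ?thesis using K MK by (simp add: period_def)
qed

end

section \<open>The semiprimitive case\<close>

lemma geometric_sum_nat: "(x - 1) * (\<Sum>i<n. x ^ i) = x ^ n - (1::nat)" if "x > 0"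
proof -
  define y where "y = x - 1"
  have "x = Suc y" using that by (simp add: y_def)
  moreover have "Suc (y * (\<Sum>i<n. Suc y ^ i)) = Suc y ^ n" by (induction n) (auto simp: algebra_simps)
  ultimately show ?thesis by (metis diff_Suc_1)
qed

lemma cong_geometric_sum: "[(\<Sum>i<n. x ^ i) = n] (mod x - (1::nat))" if "x > 0"
proof -
  have "[x = 1] (mod x - 1)" using that by (simp add: cong_altdef_nat)
  hence "[(\<Sum>i<n. x ^ i) = (\<Sum>i<n. 1)] (mod x - 1)"
    by (intro cong_sum) (metis cong_pow power_one)
  thus ?thesis by simp
qed

lemma even_geometric_sum: "odd x \<Longrightarrow> even (\<Sum>i<n. x ^ i) \<longleftrightarrow> even n" for x :: nat
  by (induction n) auto

text \<open>Modulo \<open>w + 1\<close> the number \<open>- w\<close> is \<open>1\<close>, so the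
  wrong sign would make \<open>1\<close> and \<open>- 1\<close> congruent, which is impossible as
  \<open>w + 1 > 2\<close>.\<close>

lemma cong_1_eq_power:
  fixes S :: int and w a :: nat
  assumes sq: "S ^ 2 = (int w ^ a) ^ 2" and cong: "[S = 1] (mod int (w + 1))" and w: "w > 1"
  shows "S = (- int w) ^ a"
proof (rule ccontr)
  assume "S \<noteq> (- int w) ^ a"
  moreover have "S ^ 2 = ((- int w) ^ a) ^ 2" using sq
    by (simp add: power2_eq_square flip: power_mult_distrib)
  ultimately have S: "S = - ((- int w) ^ a)" by (auto simp: power2_eq_iff)
  have "[- int w = 1] (mod int (w + 1))" by (simp add: cong_iff_dvd_diff) (metis add.commute dvd_refl dvd_minus_iff minus_diff_eq diff_minus_eq_add)
  hence "[(- int w) ^ a = 1] (mod int (w + 1))" by (metis cong_pow power_one)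
  hence "[- ((- int w) ^ a) = - 1] (mod int (w + 1))" by (simp only: cong_minus_minus_iff)
  hence "[1 = - 1] (mod int (w + 1))" using cong by (metis S cong_sym cong_trans)
  hence "int (w + 1) dvd 2" by (simp add: cong_iff_dvd_diff)
  thus False using w by (auto dest: zdvd_imp_le)
qed

text \<open>The number \<open>ga\<close> is the degree of \<open>L\<close> over the field of order
  \<open>w ^ 2\<close>, where \<open>w = p ^ e\<close>; it will be \<open>n\<close> for the field of
  order \<open>q\<close> and \<open>n * t\<close> for the field of order \<open>q ^ t\<close>.
  Modulo every divisor of \<open>w + 1\<close> the power \<open>w\<close> of \<open>p\<close> is
  congruent to \<open>- 1\<close>, whence the name.\<close>

locale semiprimitive = gf_subfield +
  fixes e ga :: nat
  assumes e: "e > 0" and k_eq: "k = 2 * e * ga"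
begin

abbreviation w :: nat where "w \<equiv> p ^ e"
text \<open>This is \<open>(Q - 1) div (w ^ 2 - 1)\<close>. For odd \<open>w\<close> its parity is
  that of \<open>ga\<close>, which decides the shift \<open>kshift\<close>.\<close>

definition G :: nat where "G = (\<Sum>i<ga. (w\<^sup>2) ^ i)"

lemma w_gt_1: "w > 1"
  by (rule one_less_power[OF prime_gt_1_nat[OF prime_p] e])

lemma Q_eq: "Q = (w\<^sup>2) ^ ga"
  by (simp add: k_eq mult_ac flip: power_mult)

lemma Q_minus_1: "Q - 1 = (w - 1) * ((w + 1) * G)"
proof -
  have "w\<^sup>2 - 1 = (w - 1) * (w + 1)" by (simp add: power2_eq_square algebra_simps)
  moreover have "(w\<^sup>2 - 1) * G = Q - 1" unfolding Q_eq G_def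
    by (rule geometric_sum_nat) (simp add: prime_gt_0_nat[OF prime_p])
  ultimately show ?thesis by (metis mult.assoc)
qed

lemma G_pos: "G > 0"
  using Q_minus_1 Q_gt_1 by (cases "G = 0") auto

text \<open>The iterated \<open>w\<close>-th powers of \<open>v\<close> alternate in sign, and the
  trace to the field of order \<open>w\<close> has \<open>2 * ga\<close> of them, so it
  vanishes.\<close>

lemma chi_eq_1:
  assumes "v ^ w = - v"
  shows "chi v = 1"
proof -
  have "v ^ (w ^ i) = (- 1) ^ i * v" for i
  proof (induction i)
    case (Suc i)
    \<comment> \<open>Valid in every characteristic, since \<open>- 1\<close> lies in each
      subfield.\<close>
    have "(- 1 :: 'a) ^ w = - 1"
      using GFsub_uminus[of "1::'a" e] by (simp add: GFsub_def p)
    moreover have "v ^ (w ^ Suc i) = (v ^ (w ^ i)) ^ w"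
      by (simp only: power_Suc2 power_mult)
    ultimately show ?case using Suc assms
      by (simp add: power_mult_distrib) (metis mult.commute power_mult)
  qed simp
  hence "gf_trace w (2 * ga) v = (\<Sum>i<2 * ga. (- 1) ^ i) * v"
    by (simp add: gf_trace_def sum_distrib_right)
  also have "(\<Sum>i<2 * ga. (- 1 :: 'a) ^ i) = 0" by (induction ga) auto
  finally have "gf_trace w (2 * ga) v = of_nat 0" by simp
  moreover have "chi v = add_char e (gf_trace w (2 * ga) v)"
    using add_char_trace[of w e "2 * ga" v] by (simp add: p k_eq mult_ac)
  moreover have "gf_trace CHAR('a) e (0::'a) = of_nat 0"
    using prime_gt_0_nat[OF prime_p] by (simp add: gf_trace_def p power_0_left)
  hence "add_char e (0::'a) = 1" using add_char_eq[of e "0::'a" 0] by simp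
  ultimately show ?thesis by simp
qed

text \<open>Substituting \<open>x = y + z\<close> in the double sum isolates for each
  \<open>z\<close> a sum over \<open>y\<close> of \<open>chi\<close> at a multiple of
  \<open>y ^ w\<close>; orthogonality leaves only the \<open>z\<close> in the radical of the
  Hermitian form.\<close>

lemma norm_square_sum:
  assumes c: "c \<in> L"
  shows "(\<Sum>x\<in>L. chi (c * x ^ (w + 1))) * cnj (\<Sum>x\<in>L. chi (c * x ^ (w + 1))) =
    of_nat (Q * card {z \<in> L. c * z + c ^ w * z ^ (w * w) = 0})"
proof -
  let ?f = "\<lambda>x. chi (c * x ^ (w + 1))"
  define D where "D z = c * z + c ^ w * z ^ (w * w)" for z
  have DL: "D z \<in> L" if "z \<in> L" for z
    using c that GFsub_add[of "c * z" k "c ^ w * z ^ (w * w)"]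
    by (simp add: D_def GFsub_mult GFsub_power p)
  have shift: "(\<Sum>x\<in>L. g x) = (\<Sum>z\<in>L. g (y + z))" if "y \<in> L" for g :: "'a \<Rightarrow> complex" and y
  proof -
    have "- y \<in> L" using that GFsub_uminus by (simp add: p)
    thus ?thesis
      by (intro sum.reindex_bij_witness[of _ "\<lambda>x. y + x" "\<lambda>x. - y + x"])
        (use that GFsub_add[of _ k y] GFsub_add[of _ k "- y"] in \<open>auto simp: p add.commute\<close>)
  qed
  have summand: "?f (y + z) * cnj (?f y) = ?f z * chi (D z * y ^ w)" if y: "y \<in> L" and z: "z \<in> L" for y z
  proof -
    have mem: "c * y ^ w * y \<in> L" "c * z * y ^ w \<in> L" "c * z ^ w * y \<in> L" "c * z ^ w * z \<in> L"
      "c ^ w * z ^ (w * w) * y ^ w \<in> L"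
      using c y z by (simp_all add: GFsub_mult GFsub_power)
    have add: "u \<in> L \<Longrightarrow> v \<in> L \<Longrightarrow> u + v \<in> L" for u v
      using GFsub_add[of u k v] by (simp add: p)
    have "(y + z) ^ w = y ^ w + z ^ w" using power_Frobenius_add[of y z e] by (simp add: p)
    hence "c * (y + z) ^ (w + 1) =
        c * y ^ w * y + (c * z * y ^ w + (c * z ^ w * y + c * z ^ w * z))"
      by (simp add: algebra_simps)
    hence "?f (y + z) =
        chi (c * y ^ w * y) * (chi (c * z * y ^ w) * (chi (c * z ^ w * y) * chi (c * z ^ w * z)))"
      using mem by (simp add: chi_add add)
    \<comment> \<open>Of the two mixed terms one contains \<open>y ^ w\<close> and the other
      \<open>y\<close>. Frobenius invariance turns the latter into a multiple of
      \<open>y ^ w\<close>, and the two combine to \<open>D z * y ^ w\<close>.\<close>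
    also have "chi (c * z ^ w * y) = chi ((c * z ^ w * y) ^ w)"
      by (rule chi_Frobenius[OF mem(3), symmetric])
    also have "(c * z ^ w * y) ^ w = c ^ w * z ^ (w * w) * y ^ w"
      by (simp add: power_mult_distrib power_mult)
    finally have "?f (y + z) = chi (c * y ^ w * y) *
        (chi (D z * y ^ w) * chi (c * z ^ w * z))"
      using mem by (simp add: D_def distrib_right chi_add)
    moreover have "chi (c * y ^ w * y) * cnj (chi (c * y ^ w * y)) = 1"
      by (simp add: complex_norm_square[symmetric])
    moreover have "?f y = chi (c * y ^ w * y)" "?f z = chi (c * z ^ w * z)"
      by (simp_all add: mult_ac)
    ultimately show ?thesis by (simp add: mult_ac)
  qed
  have "(\<Sum>x\<in>L. ?f x) * cnj (\<Sum>x\<in>L. ?f x) = (\<Sum>y\<in>L. \<Sum>x\<in>L. ?f x * cnj (?f y))"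
    unfolding cnj_sum sum_product by (rule sum.swap)
  also have "\<dots> = (\<Sum>y\<in>L. \<Sum>z\<in>L. ?f (y + z) * cnj (?f y))"
    by (rule sum.cong[OF refl]) (rule shift)
  also have "\<dots> = (\<Sum>y\<in>L. \<Sum>z\<in>L. ?f z * chi (D z * y ^ w))"
    by (intro sum.cong refl summand)
  also have "\<dots> = (\<Sum>z\<in>L. ?f z * (\<Sum>y\<in>L. chi (D z * y ^ w)))"
    unfolding sum_distrib_left by (rule sum.swap)
  also have "\<dots> = (\<Sum>z\<in>L. if D z = 0 then of_nat Q else 0)"
  proof (intro sum.cong refl)
    fix z assume z: "z \<in> L"
    have "(\<Sum>y\<in>L. chi (D z * y ^ w)) = (if D z = 0 then of_nat Q else 0)"
      using sum_chi_mult[OF DL[OF z]] sum_L_Frobenius[of "\<lambda>v. chi (D z * v)" e] by simp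
    \<comment> \<open>On the radical the \<open>w\<close>-th power negates
      \<open>c * z ^ (w + 1)\<close>, so its character value is \<open>1\<close> and each such
      \<open>z\<close> contributes exactly \<open>Q\<close>.\<close>
    moreover have "?f z = 1" if "D z = 0"
    proof (rule chi_eq_1)
      have "(c * z ^ (w + 1)) ^ w = (c ^ w * z ^ (w * w)) * z ^ w"
        by (simp add: power_mult_distrib power_mult)
      also have "c ^ w * z ^ (w * w) = - (c * z)"
        using that by (simp add: D_def add_eq_0_iff)
      finally show "(c * z ^ (w + 1)) ^ w = - (c * z ^ (w + 1))" by (simp add: mult_ac)
    qed
    ultimately show "?f z * (\<Sum>y\<in>L. chi (D z * y ^ w)) = (if D z = 0 then of_nat Q else 0)" by simp
  qed
  also have "\<dots> = (\<Sum>z | z \<in> L \<and> D z = 0. of_nat Q)"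
    by (simp only: sum.inter_filter[symmetric] finite)
  also have "\<dots> = of_nat (Q * card {z \<in> L. D z = 0})" by simp
  finally show ?thesis unfolding D_def .
qed

text \<open>For odd \<open>p\<close>, \<open>- 1 = b ^ ((Q - 1) div 2)\<close>, and this exponent is
  \<open>w - 1\<close> times \<open>h = (w + 1) div 2 * G\<close>. Modulo \<open>w + 1\<close> the
  value of \<open>h\<close> depends only on the parity of \<open>G\<close>; this is the origin of
  \<open>kshift\<close>. For \<open>p = 2\<close> one has \<open>- 1 = 1\<close> and
  \<open>h = 0\<close>.\<close>

lemma minus_1_power:
  obtains h where "(- 1 :: 'a) = b ^ ((w - 1) * h)" "[h = kshift p e ga (w + 1) 1] (mod w + 1)"
proof (cases "p = 2")
  case True
  hence "(- 1 :: 'a) = b ^ ((w - 1) * 0)" using uminus_CHAR_2[of "1::'a"] by (simp add: p)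
  moreover have "kshift p e ga (w + 1) 1 = 0" using True by (simp add: kshift_def)
  ultimately show ?thesis by (metis cong_refl that)
next
  case False
  hence p2: "p > 2" using prime_ge_2_nat[OF prime_p] by simp
  hence "odd p" using prime_odd_nat prime_p by blast
  hence ow: "odd w" by simp
  define h where "h = (w + 1) div 2 * G"
  have w2: "w + 1 = 2 * ((w + 1) div 2)" using ow by simp
  have h2: "(w - 1) * h * 2 = Q - 1" 
  proof -
    have "(w - 1) * h * 2 = (w - 1) * ((2 * ((w + 1) div 2)) * G)" by (simp only: h_def mult_ac)
    thus ?thesis by (simp only: w2[symmetric] Q_minus_1)
  qed
  have hpos: "(w - 1) * h > 0" using h2 Q_gt_1 by linarith
  have "(b ^ ((w - 1) * h)) ^ 2 = 1" unfolding power_mult[symmetric] h2 by (rule b_power_Q)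
  moreover have "b ^ ((w - 1) * h) \<noteq> 1"
    unfolding order h2[symmetric] using hpos by (auto dest: dvd_imp_le)
  ultimately have "(- 1 :: 'a) = b ^ ((w - 1) * h)" by (metis power2_eq_1_iff)
  moreover have "[h = kshift p e ga (w + 1) 1] (mod w + 1)"
  proof (cases "even ga")
    case True
    hence "even G" using even_geometric_sum[of "w\<^sup>2"] ow by (simp add: G_def)
    then obtain s where "G = 2 * s" by blast
    hence "h = (2 * ((w + 1) div 2)) * s" by (simp add: h_def)
    hence "h = (w + 1) * s" using w2 by metis
    hence "w + 1 dvd h" by (simp only: dvd_triv_left)
    thus ?thesis using True by (simp add: kshift_def cong_0_iff)
  next
    case False
    hence "odd G" using even_geometric_sum[of "w\<^sup>2"] ow by (simp add: G_def)
    then obtain s where "G = 2 * s + 1" by (elim oddE)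
    hence "h = (2 * ((w + 1) div 2)) * s + (w + 1) div 2" by (simp add: h_def algebra_simps)
    hence "h = (w + 1) * s + (w + 1) div 2" using w2 by metis
    hence "[h = (w + 1) div 2] (mod w + 1)" by (simp only: cong_def mod_mult_self4)
    thus ?thesis using False p2 by (simp add: kshift_def)
  qed
  ultimately show ?thesis by (rule that)
qed

text \<open>For \<open>z = b ^ i\<close> the equation compares exponents modulo
  \<open>Q - 1\<close>; after the factor \<open>w - 1\<close> is cancelled it says that
  \<open>(w + 1) * i\<close> is \<open>h - j\<close> modulo \<open>G * (w + 1)\<close>. If solvable,
  it has one class modulo \<open>G\<close>, hence \<open>(w - 1) * (w + 1)\<close> nonzero
  solutions, and \<open>z = 0\<close> completes these to \<open>w ^ 2\<close>.\<close>

lemma card_radical: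
  "card {z \<in> L. b ^ j * z + (b ^ j) ^ w * z ^ (w * w) = 0} =
    (if [j = kshift p e ga (w + 1) 1] (mod w + 1) then w\<^sup>2 else 1)"
proof -
  obtain h where h: "(- 1 :: 'a) = b ^ ((w - 1) * h)" "[h = kshift p e ga (w + 1) 1] (mod w + 1)"
    by (rule minus_1_power)
  define P where "P i \<longleftrightarrow> [int (w + 1) * int i = int h - int j] (mod int (G * (w + 1)))" for i
  have P: "b ^ j * b ^ i + (b ^ j) ^ w * (b ^ i) ^ (w * w) = 0 \<longleftrightarrow> P i" for i
  proof -
    have "b ^ j * b ^ i + (b ^ j) ^ w * (b ^ i) ^ (w * w) = 0 \<longleftrightarrow>
        (b ^ j) ^ w * (b ^ i) ^ (w * w) = - 1 * (b ^ j * b ^ i)"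
      by (simp add: add_eq_0_iff)
    also have "\<dots> \<longleftrightarrow> b ^ (j * w + i * (w * w)) = b ^ ((w - 1) * h + (j + i))"
      unfolding h(1) by (simp only: power_add power_mult)
    also have "\<dots> \<longleftrightarrow> int (Q - 1) dvd int (j * w + i * (w * w)) - int ((w - 1) * h + (j + i))"
      by (simp only: b_power_eq_iff cong_iff_dvd_diff flip: cong_int_iff)
    also have "int (j * w + i * (w * w)) - int ((w - 1) * h + (j + i)) =
        int (w - 1) * (int (w + 1) * int i - (int h - int j))"
    proof -
      have "int (w - 1) = int w - 1" using w_gt_1 by linarith
      thus ?thesis by (simp only: of_nat_add of_nat_mult of_nat_1) (simp add: algebra_simps)
    qed
    also have "int (Q - 1) = int (w - 1) * int (G * (w + 1))"
      by (simp only: Q_minus_1 of_nat_mult mult_ac)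
    also have "int (w - 1) * int (G * (w + 1)) dvd int (w - 1) * (int (w + 1) * int i - (int h - int j)) \<longleftrightarrow> P i"
    proof -
      have "int (w - 1) \<noteq> 0" using w_gt_1 by linarith
      thus ?thesis by (simp only: P_def cong_iff_dvd_diff dvd_mult_cancel_left simp_thms)
    qed
    finally show ?thesis .
  qed
  have inj: "inj_on (\<lambda>i. b ^ i) {..<Q - 1}"
    by (auto simp: inj_on_def b_power_eq_iff cong_def)
  have "{z \<in> L. b ^ j * z + (b ^ j) ^ w * z ^ (w * w) = 0} =
      insert 0 ((\<lambda>i. b ^ i) ` {i \<in> {..<Q - 1}. P i})"
    using prime_gt_0_nat[OF prime_p] unfolding L_eq by (auto simp: P)
  also have "card \<dots> = Suc (card {i \<in> {..<Q - 1}. P i})"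
  proof (subst card_insert_disjoint)
    have "inj_on (\<lambda>i. b ^ i) {i \<in> {..<Q - 1}. P i}" by (rule inj_on_subset[OF inj]) auto
    thus "Suc (card ((\<lambda>i. b ^ i) ` {i \<in> {..<Q - 1}. P i})) = Suc (card {i \<in> {..<Q - 1}. P i})"
      by (simp only: card_image)
  qed (use b_nonzero in auto)
  also have "\<dots> = (if [j = kshift p e ga (w + 1) 1] (mod w + 1) then w\<^sup>2 else 1)"
  proof -
    have *: "int (w + 1) dvd int h - int j \<longleftrightarrow> [j = kshift p e ga (w + 1) 1] (mod w + 1)"
      unfolding cong_iff_dvd_diff[symmetric] cong_int_iff using h(2) by (metis cong_sym cong_trans)
    show ?thesis
    proof (cases "int (w + 1) dvd int h - int j")
      case True
      then obtain x0 where x0: "x0 < G" "\<And>x. P x \<longleftrightarrow> [x = x0] (mod G)"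
        using cong_int_mult_iff_ex1(2)[of G "w + 1" "int h - int j"] G_pos unfolding P_def by auto
      have "Q - 1 = G * ((w - 1) * (w + 1))" by (simp only: Q_minus_1 mult_ac)
      hence "{i \<in> {..<Q - 1}. P i} = {i. i < G * ((w - 1) * (w + 1)) \<and> [i = x0] (mod G)}"
        using x0(2) by auto
      hence "card {i \<in> {..<Q - 1}. P i} = (w - 1) * (w + 1)"
        using sum_residue_class[OF x0(1), of "\<lambda>_. 1::nat" "(w - 1) * (w + 1)"] by simp
      moreover have "Suc ((w - 1) * (w + 1)) = w\<^sup>2"
        using w_gt_1 by (cases w) (simp_all add: power2_eq_square)
      ultimately show ?thesis using True * by simp
    next
      case False
      hence "\<not> P i" for i
        using cong_int_mult_iff_ex1(1)[of G "w + 1" "int h - int j"] G_pos unfolding P_def by auto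
      thus ?thesis using False * by simp
    qed
  qed
  finally show ?thesis .
qed

text \<open>The value is written as a generic part minus a correction at the distinguished class, a
  shape that can be summed over cosets. It says that the exponential sum is
  \<open>(- w) ^ ga\<close> generically and \<open>(- w) ^ (ga + 1)\<close> at that class.\<close>

lemma period_largest:
  "of_nat (w + 1) * period (w + 1) j = (- of_nat w) ^ ga - 1 -
     (if [j = kshift p e ga (w + 1) 1] (mod w + 1) then of_nat (w + 1) * (- of_nat w) ^ ga else 0)"
proof -
  \<comment> \<open>Integrality of the period: \<open>p - 1\<close> divides \<open>w - 1\<close>,
    which is a factor of \<open>Q - 1\<close> beside \<open>w + 1\<close>.\<close>
  have "(w + 1) * (p - 1) dvd Q - 1"
  proof -
    have "p - 1 dvd w - 1"
      using geometric_sum_nat[of p e] prime_gt_0_nat[OF prime_p] by (metis dvd_triv_left)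
    hence "(p - 1) * (w + 1) dvd (w - 1) * (w + 1)" by (rule mult_dvd_mono) simp
    thus ?thesis unfolding Q_minus_1 by (metis dvd_mult2 mult.assoc mult.commute)
  qed
  hence "period (w + 1) j \<in> \<int>" by (rule period_in_Ints)
  then obtain eta where eta: "period (w + 1) j = of_int eta" by (auto elim: Ints_cases)
  define S where "S = 1 + int (w + 1) * eta"
  have "w + 1 dvd Q - 1" unfolding Q_minus_1 by (metis dvd_triv_left dvd_mult)
  hence S: "(\<Sum>x\<in>L. chi (b ^ j * x ^ (w + 1))) = of_int S"
    by (simp only: sum_power_eq_period S_def eta of_int_add of_int_mult of_int_of_nat_eq of_int_1)
  \<comment> \<open>As \<open>S\<close> is an integer, its absolute square is its square.\<close>
  have "(of_int (S ^ 2) :: complex) = of_int S * cnj (of_int S)"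
    by (simp add: power2_eq_square)
  also have "\<dots> = of_nat (Q * (if [j = kshift p e ga (w + 1) 1] (mod w + 1) then w\<^sup>2 else 1))"
    using norm_square_sum[OF b_in_L, of j] by (simp only: S card_radical)
  also have "\<dots> = of_int (int (Q * (if [j = kshift p e ga (w + 1) 1] (mod w + 1) then w\<^sup>2 else 1)))"
    by (simp only: of_int_of_nat_eq)
  finally have *: "S ^ 2 = int (Q * (if [j = kshift p e ga (w + 1) 1] (mod w + 1) then w\<^sup>2 else 1))"
    by (simp only: of_int_eq_iff)
  have cong: "[S = 1] (mod int (w + 1))" by (simp add: S_def cong_iff_dvd_diff)
  have Qsq: "int Q = (int w ^ ga) ^ 2"
    by (metis Q_eq mult.commute of_nat_power power_mult)
  have "S = (if [j = kshift p e ga (w + 1) 1] (mod w + 1) then (- int w) ^ Suc ga else (- int w) ^ ga)"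
  proof (cases "[j = kshift p e ga (w + 1) 1] (mod w + 1)")
    case True
    have "int (Q * w\<^sup>2) = (int w ^ Suc ga) ^ 2"
      unfolding of_nat_mult Qsq by (simp add: power_mult_distrib mult.commute)
    hence "S ^ 2 = (int w ^ Suc ga) ^ 2" by (simp only: * True if_True)
    from cong_1_eq_power[OF this cong w_gt_1] show ?thesis using True by simp
  next
    case False
    have "S ^ 2 = (int w ^ ga) ^ 2" 
      by (simp only: * False if_False mult_1_right Qsq)
    from cong_1_eq_power[OF this cong w_gt_1] show ?thesis using False by simp
  qed
  hence 1: "complex_of_int S =
      (if [j = kshift p e ga (w + 1) 1] (mod w + 1) then (- of_nat w) ^ Suc ga else (- of_nat w) ^ ga)"
    by simp
  have "of_nat (w + 1) * period (w + 1) j = complex_of_int S - 1"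
    by (simp only: S_def eta of_int_add of_int_mult of_int_of_nat_eq of_int_1 add_diff_cancel_left')
  also have "\<dots> = (- of_nat w) ^ ga - 1 -
      (if [j = kshift p e ga (w + 1) 1] (mod w + 1) then of_nat (w + 1) * (- of_nat w) ^ ga else 0)"
    unfolding 1 by (simp add: algebra_simps)
  finally show ?thesis .
qed

end

text \<open>Where shifts can be nonzero, all are reductions of the one for
  \<open>p ^ e + 1 = N * A\<close>: for odd \<open>A\<close> the number \<open>N\<close> is even and
  \<open>N * A div 2\<close> is \<open>N div 2\<close> modulo \<open>N\<close>, for even
  \<open>A\<close> it is \<open>0\<close>. Two divisors are compared through this largest
  one.\<close>

lemma kshift_cong:
  assumes "prime p" "N' dvd N" "N dvd p ^ e + 1"
  shows "[kshift p e n N t = kshift p e n N' t] (mod N')"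
proof -
  have *: "[kshift p e n (p ^ e + 1) t = kshift p e n N t] (mod N)" if N_dvd: "N dvd p ^ e + 1" for N
  proof -
    obtain A where A: "p ^ e + 1 = N * A" using N_dvd by (elim dvdE)
    hence N: "N > 0" "(p ^ e + 1) div N = A" by (auto intro!: Nat.gr0I)
    show ?thesis
    proof (cases "p > 2 \<and> odd (n * t)")
      case True
      have kM: "kshift p e n (p ^ e + 1) t = N * A div 2"
        using True by (simp add: kshift_def A[symmetric])
      have kN: "kshift p e n N t = (if odd A then N div 2 else 0)"
        using True N by (simp add: kshift_def)
      show ?thesis
      proof (cases "odd A")
        case True
        have "odd p" using \<open>prime p\<close> \<open>p > 2 \<and> odd (n * t)\<close> prime_odd_nat by blast
        hence "even (N * A)" by (simp flip: A)
        with True obtain c s where cs: "N = 2 * c" "A = 2 * s + 1" by (auto elim!: oddE evenE)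
        hence "N * A div 2 = N * s + c" by (simp add: algebra_simps)
        thus ?thesis using True cs(1) unfolding kM kN by (simp add: cong_def)
      next
        case False
        then obtain s where "A = 2 * s" using evenE by blast
        hence "N * A div 2 = N * s" by simp
        thus ?thesis using False unfolding kM kN by (simp add: cong_0_iff)
      qed
    qed (auto simp: kshift_def)
  qed
  have "N' dvd p ^ e + 1" using assms(2,3) by (rule dvd_trans)
  from *[OF this] *[OF assms(3), THEN cong_dvd_modulus_nat, OF assms(2)]
  show ?thesis by (metis cong_sym cong_trans)
qed

lemma kshift_mult: "kshift p e n N t = kshift p e (n * t) N 1"
  by (simp add: kshift_def)

text \<open>With \<open>w + 1 = N * A\<close> the period of order \<open>N\<close> is the sum of the
  \<open>A\<close> periods of order \<open>w + 1\<close> at \<open>j + N * a\<close>. The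
  distinguished class modulo \<open>w + 1\<close> is met by exactly one \<open>a\<close> if
  \<open>j\<close> lies in its reduction modulo \<open>N\<close>, and by none otherwise.\<close>

lemma (in semiprimitive) period_eq:
  assumes N: "N dvd w + 1"
  shows "of_nat N * period N j = (- of_nat w) ^ ga - 1 -
     (if [j = kshift p e ga N 1] (mod N) then of_nat N * (- of_nat w) ^ ga else 0)"
proof -
  obtain A where A: "w + 1 = N * A" using N by (elim dvdE)
  hence pos: "N > 0" "A > 0" by (auto intro!: Nat.gr0I)
  define W :: complex where "W = (- of_nat w) ^ ga"
  define kM where "kM = kshift p e ga (w + 1) 1"
  define B where "B \<longleftrightarrow> [j = kshift p e ga N 1] (mod N)"
  have kM: "[kM = kshift p e ga N 1] (mod N)" unfolding kM_def by (rule kshift_cong[OF prime_p N dvd_refl])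
  have count: "(\<Sum>a<A. if [j + N * a = kM] (mod w + 1) then 1 else 0) = (if B then 1 else (0::complex))"
  proof -
    have eq: "[j + N * a = kM] (mod w + 1) \<longleftrightarrow> [int N * int a = int kM - int j] (mod int (A * N))" for a
    proof -
      have "[j + N * a = kM] (mod w + 1) \<longleftrightarrow> [int (j + N * a) = int kM] (mod int (A * N))"
        unfolding A cong_int_iff by (simp only: mult.commute)
      thus ?thesis by (simp add: cong_iff_dvd_diff algebra_simps)
    qed
    have B: "int N dvd int kM - int j \<longleftrightarrow> B"
      unfolding B_def cong_iff_dvd_diff[symmetric] cong_int_iff using kM by (metis cong_sym cong_trans)
    show ?thesis
    proof (cases B)
      case True
      then obtain x0 where x0: "x0 < A" "\<And>a. [j + N * a = kM] (mod w + 1) \<longleftrightarrow> [a = x0] (mod A)"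
        using cong_int_mult_iff_ex1(2)[OF pos(2,1)] B unfolding eq by blast
      have "(\<Sum>a<A. if [j + N * a = kM] (mod w + 1) then 1 else 0) = (\<Sum>a<A. if a = x0 then 1 else (0::complex))"
        using x0 by (intro sum.cong refl) (auto simp: cong_less_modulus_unique_nat)
      thus ?thesis using True x0(1) by simp
    next
      case False
      hence "\<not> [j + N * a = kM] (mod w + 1)" for a
        using cong_int_mult_iff_ex1(1)[OF pos(2,1)] B unfolding eq by blast
      thus ?thesis using False by simp
    qed
  qed
  have "N * A dvd Q - 1" unfolding Q_minus_1 A[symmetric] by (metis dvd_triv_left dvd_mult)
  hence "of_nat (w + 1) * period N j = (\<Sum>a<A. of_nat (w + 1) * period (w + 1) (j + N * a))"
    using period_mult[of N A j] pos by (simp only: A sum_distrib_left)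
  also have "\<dots> = (\<Sum>a<A. (W - 1) - of_nat (w + 1) * W * (if [j + N * a = kM] (mod w + 1) then 1 else 0))"
    by (intro sum.cong refl) (subst period_largest, simp add: W_def kM_def)
  also have "\<dots> = of_nat A * (W - 1) - of_nat (w + 1) * W * (if B then 1 else 0)"
    by (simp only: sum_subtractf sum_constant card_lessThan sum_distrib_left[symmetric] count
        right_diff_distrib)
  finally have "of_nat A * (of_nat N * period N j) = of_nat A * ((W - 1) - (if B then of_nat N * W else 0))"
    unfolding A by (simp add: algebra_simps split: if_splits)
  thus ?thesis using pos unfolding W_def B_def by simp
qed

section \<open>Counting elements of given trace and norm\<close>

text \<open>Detect the trace condition with the characters of the small field; every inner sum is then a
  Gaussian period of the large field.\<close>

lemma coset_trace_count:
  fixes b g c :: "'a::{field,finite}"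
  assumes F: "gf_subfield p r g" and K: "gf_subfield p (r * t) b"
    and g: "g = b ^ t0" and S: "S dvd p ^ (r * t) - 1"
    and c: "c \<in> GFsub (p ^ r)" and del: "b ^ del \<in> GFsub (p ^ r)"
  shows "of_nat (p ^ r) *
      of_nat (card {x \<in> {b ^ i |i. [i = i0] (mod S)}. gf_trace (p ^ r) t x = c}) =
    of_nat ((p ^ (r * t) - 1) div S) +
    (\<Sum>j<p ^ r - 1. add_char r (- (c * b ^ del) * g ^ j) *
       gf_subfield.period p (r * t) b S (i0 + del + t0 * j))"
proof -
  interpret F: gf_subfield p r g by (rule F)
  interpret K: gf_subfield p "r * t" b by (rule K)
  define C where "C = {b ^ i |i. [i = i0] (mod S)}"
  have FK: "F.L \<subseteq> K.L" using GFsub_power_subset[of "p ^ r" t] by (simp add: power_mult)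
  have CK: "C \<subseteq> K.L" using K.b_in_L by (auto simp: C_def)
  have tr: "gf_trace (p ^ r) t x \<in> F.L" if "x \<in> K.L" for x :: 'a
    using that gf_trace_in_GFsub[of "p ^ r" r x t] by (simp add: F.p power_mult)
  have add: "x + y \<in> F.L" "- x \<in> F.L" if "x \<in> F.L" "y \<in> F.L" for x y
    using that GFsub_add[of x r y] GFsub_uminus[of x r] by (simp_all add: F.p)
  have diff: "gf_trace (p ^ r) t x - c \<in> F.L" if "x \<in> C" for x
  proof -
    have "gf_trace (p ^ r) t x \<in> F.L" using tr that CK by auto
    from add(1)[OF this add(2)[OF c c]] show ?thesis by simp
  qed
  \<comment> \<open>The multiplier \<open>y\<close> lies in the small field, so it moves inside the
    relative trace, and the small character of that trace is the large character of
    \<open>y * x\<close>.\<close>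
  have chi: "F.chi ((gf_trace (p ^ r) t x - c) * y) = F.chi (- (c * y)) * K.chi (y * x)"
    if x: "x \<in> C" and y: "y \<in> F.L" for x y
  proof -
    have t1: "gf_trace (p ^ r) t x * y \<in> F.L" using tr x y CK by (auto intro: GFsub_mult)
    have t2: "- (c * y) \<in> F.L" using add(2) GFsub_mult[OF c y] by blast
    have "F.chi ((gf_trace (p ^ r) t x - c) * y) = F.chi (gf_trace (p ^ r) t x * y + - (c * y))"
      by (simp add: algebra_simps)
    also have "\<dots> = F.chi (gf_trace (p ^ r) t x * y) * F.chi (- (c * y))" by (rule F.chi_add[OF t1 t2])
    also have "gf_trace (p ^ r) t x * y = gf_trace (p ^ r) t (y * x)"
      using gf_trace_mult_left[OF y, of t x] by (simp add: mult.commute)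
    also have "F.chi \<dots> = K.chi (y * x)" by (rule add_char_trace[symmetric]) (simp add: F.p)
    finally show ?thesis by (simp only: mult.commute)
  qed
  define H where "H y = F.chi (- (c * y)) * (\<Sum>x\<in>C. K.chi (y * x))" for y
  have "of_nat (p ^ r) * of_nat (card {x \<in> C. gf_trace (p ^ r) t x = c}) =
      (\<Sum>x\<in>{x \<in> C. gf_trace (p ^ r) t x = c}. complex_of_nat (p ^ r))"
    by (simp only: sum_constant mult.commute)
  also have "\<dots> = (\<Sum>x\<in>C. if gf_trace (p ^ r) t x - c = 0 then of_nat (p ^ r) else 0)"
    by (subst sum.inter_filter) auto
  also have "\<dots> = (\<Sum>x\<in>C. \<Sum>y\<in>F.L. F.chi ((gf_trace (p ^ r) t x - c) * y))"
    by (intro sum.cong refl F.sum_chi_mult[symmetric] diff)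
  also have "\<dots> = (\<Sum>x\<in>C. \<Sum>y\<in>F.L. F.chi (- (c * y)) * K.chi (y * x))"
    by (intro sum.cong refl chi)
  also have "\<dots> = (\<Sum>y\<in>F.L. H y)"
    unfolding H_def sum_distrib_left by (rule sum.swap)
  \<comment> \<open>Multiplication by \<open>b ^ del\<close> permutes the small field. The free
    parameter \<open>del\<close> later normalises \<open>- (c * b ^ del)\<close> to \<open>1\<close>
    when \<open>c\<close> is nonzero.\<close>
  also have "\<dots> = (\<Sum>y\<in>F.L. H (b ^ del * y))"
    by (rule F.sum_L_mult[symmetric]) (use del K.b_nonzero in auto)
  also have "\<dots> = H 0 + (\<Sum>j<p ^ r - 1. H (b ^ del * g ^ j))"
    by (subst F.sum_L) simp
  also have "H 0 = of_nat ((p ^ (r * t) - 1) div S)"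
  proof -
    have "card C = (p ^ (r * t) - 1) div S"
      unfolding C_def K.period_reindex(2)[OF S, symmetric] card_image[OF K.period_reindex(1)[OF S]]
      by simp
    thus ?thesis by (simp add: H_def F.chi_0 K.chi_0)
  qed
  also have "(\<Sum>j<p ^ r - 1. H (b ^ del * g ^ j)) =
     (\<Sum>j<p ^ r - 1. F.chi (- (c * b ^ del) * g ^ j) * K.period S (i0 + del + t0 * j))"
  proof (intro sum.cong refl)
    fix j
    have "(\<Sum>x\<in>C. K.chi (b ^ del * g ^ j * x)) =
        (\<Sum>i<(K.Q - 1) div S. K.chi (b ^ del * g ^ j * b ^ (i0 + S * i)))"
      unfolding C_def K.period_reindex(2)[OF S, symmetric]
      by (simp only: sum.reindex[OF K.period_reindex(1)[OF S]] o_def)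
    also have "\<dots> = K.period S (i0 + del + t0 * j)"
    proof -
      have "b ^ del * g ^ j * b ^ (i0 + S * i) = b ^ (i0 + del + t0 * j + S * i)" for i
        by (simp only: g power_add power_mult[symmetric] mult_ac)
      thus ?thesis unfolding K.period_def by simp
    qed
    finally show "H (b ^ del * g ^ j) = F.chi (- (c * b ^ del) * g ^ j) * K.period S (i0 + del + t0 * j)"
      unfolding H_def by (simp add: mult_ac)
  qed
  finally show ?thesis unfolding C_def .
qed

section \<open>Primitive elements and congruences between exponents\<close>

lemma primitive_element_order:
  fixes z :: "'a::{field,finite}"
  assumes "primitive_element z"
  shows "z ^ i = 1 \<longleftrightarrow> CARD('a) - 1 dvd i"
proof -
  have z0: "z \<noteq> 0" and range: "range (\<lambda>k::int. z powi k) = UNIV - {0}"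
    using assms by (auto simp: primitive_element_def cyclic_subgroup_def)
  have "\<not> inj (\<lambda>i::nat. z ^ i)"
    using finite_imageD[of "\<lambda>i::nat. z ^ i" UNIV] infinite_UNIV_nat by auto
  then obtain i j where ij: "i < j" "z ^ i = z ^ j"
    by (auto simp: inj_def) (metis linorder_neqE_nat)
  hence "z ^ (j - i) = 1 \<and> j - i > 0" using z0 by (simp add: power_diff)
  \<comment> \<open>The hypothesis only says that the integer powers cover the nonzero elements. The
    least positive exponent \<open>od\<close> yields exactly \<open>od\<close> distinct powers, so
    counting identifies it with \<open>CARD('a) - 1\<close>.\<close>
  define od where "od = (LEAST n. z ^ n = 1 \<and> n > 0)"
  have od: "z ^ od = 1" "od > 0"
    using LeastI[of "\<lambda>n. z ^ n = 1 \<and> n > 0", OF \<open>z ^ (j - i) = 1 \<and> j - i > 0\<close>]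
    unfolding od_def[symmetric] by auto
  have least: "od \<le> n" if "z ^ n = 1" "n > 0" for n
    unfolding od_def using that by (intro Least_le) auto
  have dvd: "z ^ n = 1 \<longleftrightarrow> od dvd n" for n
  proof
    assume "z ^ n = 1"
    moreover have "z ^ n = (z ^ od) ^ (n div od) * z ^ (n mod od)"
      by (simp flip: power_mult power_add)
    ultimately have "z ^ (n mod od) = 1" using od by simp
    hence "n mod od = 0" using least[of "n mod od"] od(2) mod_less_divisor[of od n] by linarith
    thus "od dvd n" by auto
  qed (use od in \<open>auto simp: power_mult\<close>)
  have inj: "inj_on (\<lambda>i. z ^ i) {..<od}"
  proof (rule linorder_inj_onI')
    fix i j assume "i \<in> {..<od}" "j \<in> {..<od}" "i < j"
    moreover have False if "z ^ i = z ^ j"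
    proof -
      have "z ^ (j - i) = 1" using that \<open>i < j\<close> z0 by (simp add: power_diff)
      from least[OF this] show False using \<open>i < j\<close> \<open>j \<in> {..<od}\<close> by auto
    qed
    ultimately show "z ^ i \<noteq> z ^ j" by blast
  qed
  have "range (\<lambda>k::int. z powi k) = (\<lambda>i. z ^ i) ` {..<od}"
  proof (intro equalityI subsetI)
    fix x assume "x \<in> range (\<lambda>k::int. z powi k)"
    then obtain k :: int where "x = z powi k" by blast
    also have "k = int od * (k div int od) + int (nat (k mod int od))"
      using od by simp
    also have "z powi \<dots> = z powi (int od * (k div int od)) * z powi int (nat (k mod int od))"
      using z0 by (intro power_int_add) auto
    also have "\<dots> = z ^ nat (k mod int od)"
      by (simp only: power_int_mult power_int_of_nat od power_int_1_left mult_1_left)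
    finally have "x = z ^ nat (k mod int od)" .
    moreover have "nat (k mod int od) < od" using od by (simp add: nat_less_iff)
    ultimately show "x \<in> (\<lambda>i. z ^ i) ` {..<od}" by blast
  next
    fix x assume "x \<in> (\<lambda>i. z ^ i) ` {..<od}"
    then obtain i where "x = z powi int i" by auto
    thus "x \<in> range (\<lambda>k::int. z powi k)" by blast
  qed
  hence "card (UNIV - {0 :: 'a}) = od" using range card_image[OF inj] by simp
  hence "CARD('a) - 1 = od" by (simp add: card_Diff_singleton)
  thus ?thesis using dvd by simp
qed

text \<open>Coset membership is an equation of exponents modulo \<open>od\<close> with an integer
  \<open>k\<close> to be found; since \<open>s\<close> divides \<open>od\<close>, it reduces to a
  congruence modulo \<open>s\<close>.\<close>

lemma power_in_coset_iff:
  fixes z :: "'a::{field,finite}"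
  assumes order: "\<And>i. z ^ i = 1 \<longleftrightarrow> od dvd i" and od: "od > 0" and s: "s dvd od"
  shows "z ^ a \<in> (\<lambda>y. z ^ h * y) ` cyclic_subgroup (z ^ s) \<longleftrightarrow> [a = h] (mod s)"
proof -
  have z0: "z \<noteq> 0"
    using order[of od] od by (metis dvd_refl power_0_left not_gr_zero zero_neq_one)
  have powi: "z powi k = 1 \<longleftrightarrow> int od dvd k" for k
  proof (cases "k \<ge> 0")
    case True
    then obtain n where "k = int n" by (metis nonneg_int_cases)
    thus ?thesis using order[of n] by simp
  next
    case False
    then obtain n where "k = - int n" by (metis neg_int_cases linorder_not_le)
    thus ?thesis using order[of n] by (simp add: power_int_minus)
  qed
  have eq: "z ^ a = z ^ h * (z ^ s) powi k \<longleftrightarrow> int od dvd (int a - int h - int s * k)" for k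
  proof -
    have "z ^ a = z ^ h * (z ^ s) powi k \<longleftrightarrow> z powi (int a) = z powi (int h + int s * k)"
      using z0 by (simp add: power_int_add power_int_mult)
    also have "\<dots> \<longleftrightarrow> z powi (int a - (int h + int s * k)) = 1"
      using z0 by (simp add: power_int_diff)
    finally show ?thesis unfolding powi by (simp add: algebra_simps)
  qed
  have "z ^ a \<in> (\<lambda>y. z ^ h * y) ` cyclic_subgroup (z ^ s) \<longleftrightarrow>
      (\<exists>k. int od dvd (int a - int h - int s * k))"
    unfolding cyclic_subgroup_def image_image eq[symmetric] by blast
  also have "\<dots> \<longleftrightarrow> int s dvd int a - int h"
  proof
    assume "\<exists>k. int od dvd (int a - int h - int s * k)"
    then obtain k where "int s dvd int a - int h - int s * k"
      using s by (meson dvd_trans int_dvd_int_iff)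
    thus "int s dvd int a - int h" by (metis dvd_diffD dvd_triv_left diff_add_cancel dvd_add)
  next
    assume "int s dvd int a - int h"
    then obtain k where "int a - int h = int s * k" by (elim dvdE)
    thus "\<exists>k. int od dvd (int a - int h - int s * k)" by (intro exI[of _ k]) simp
  qed
  also have "\<dots> \<longleftrightarrow> [a = h] (mod s)" by (simp only: cong_iff_dvd_diff[symmetric] cong_int_iff)
  finally show ?thesis .
qed

lemma order_power:
  fixes z :: "'a::monoid_mult"
  assumes "\<And>i. z ^ i = 1 \<longleftrightarrow> A * B dvd i" and "A > (0::nat)"
  shows "(z ^ A) ^ i = 1 \<longleftrightarrow> B dvd i"
  using assms by (simp flip: power_mult)

lemma cong_coprime_ex1:
  fixes A B :: nat and z :: int
  assumes "coprime A B" "B > 0"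
  shows "\<exists>x0<B. \<forall>x. [int A * int x = z] (mod int B) \<longleftrightarrow> [x = x0] (mod B)"
proof -
  have cop: "coprime (int A) (int B)" using assms(1) by simp
  then obtain y where y: "[int A * y = 1] (mod int B)" using cong_solve_coprime_int by blast
  define x0 where "x0 = nat (y * z mod int B)"
  have x0: "int x0 = y * z mod int B" using assms by (simp add: x0_def)
  have "x0 < B" using assms by (simp add: x0_def nat_less_iff)
  moreover have "[int A * int x = z] (mod int B) \<longleftrightarrow> [x = x0] (mod B)" for x
  proof -
    have "[int A * (y * z) = z] (mod int B)"
      using cong_mult[OF y cong_refl[of z]] by (simp add: mult.assoc)
    hence "[int A * int x = z] (mod int B) \<longleftrightarrow> [int A * int x = int A * (y * z)] (mod int B)"
      by (metis cong_sym cong_trans)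
    also have "\<dots> \<longleftrightarrow> [int x = y * z] (mod int B)" by (rule cong_mult_lcancel[OF cop])
    also have "\<dots> \<longleftrightarrow> [int x = int x0] (mod int B)" by (simp add: x0 cong_def)
    finally show ?thesis by (simp add: cong_int_iff)
  qed
  ultimately show ?thesis by blast
qed

text \<open>Everything is multiplied by \<open>S\<close> so that the explicit periods can be
  inserted. Their constant part multiplies the complete character sum, and the correction restricts
  the sum to the indices \<open>j\<close> whose period is exceptional.\<close>

lemma semiprimitive_trace_count:
  fixes b g c :: "'a::{field,finite}"
  assumes F: "gf_subfield p r g" and K: "semiprimitive p (r * t) b e ga"
    and g: "g = b ^ t0" and S: "S dvd p ^ e + 1"
    and c: "c \<in> GFsub (p ^ r)" and del: "b ^ del \<in> GFsub (p ^ r)"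
  shows "of_nat S * (of_nat (p ^ r) *
      of_nat (card {x \<in> {b ^ i |i. [i = i0] (mod S)}. gf_trace (p ^ r) t x = c})) =
    of_nat (p ^ (r * t) - 1) +
    ((- of_nat (p ^ e)) ^ ga - 1) * (\<Sum>j<p ^ r - 1. add_char r (- (c * b ^ del) * g ^ j)) -
    of_nat S * (- of_nat (p ^ e)) ^ ga *
      (\<Sum>j | j < p ^ r - 1 \<and> [i0 + del + t0 * j = kshift p e ga S 1] (mod S).
         add_char r (- (c * b ^ del) * g ^ j))"
proof -
  interpret K: semiprimitive p "r * t" b e ga by (rule K)
  define xi where "xi j = add_char r (- (c * b ^ del) * g ^ j)" for j
  define W :: complex where "W = (- of_nat (p ^ e)) ^ ga"
  define B where "B j \<longleftrightarrow> [i0 + del + t0 * j = kshift p e ga S 1] (mod S)" for j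
  have SQ: "S dvd p ^ (r * t) - 1"
    unfolding K.Q_minus_1 using S by (metis dvd_mult dvd_mult2)
  have per: "of_nat S * K.period S (i0 + del + t0 * j) = W - 1 - (if B j then of_nat S * W else 0)" for j
    unfolding W_def B_def by (rule K.period_eq[OF S])
  have "of_nat S * (of_nat (p ^ r) *
      of_nat (card {x \<in> {b ^ i |i. [i = i0] (mod S)}. gf_trace (p ^ r) t x = c})) =
    of_nat S * of_nat ((p ^ (r * t) - 1) div S) +
    (\<Sum>j<p ^ r - 1. xi j * (of_nat S * K.period S (i0 + del + t0 * j)))"
    unfolding coset_trace_count[OF F K.gf_subfield_axioms g SQ c del] xi_def
    by (simp only: distrib_left sum_distrib_left mult.left_commute)
  also have "of_nat S * of_nat ((p ^ (r * t) - 1) div S) = complex_of_nat (p ^ (r * t) - 1)"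
    using SQ by (metis dvd_mult_div_cancel of_nat_mult)
  also have "(\<Sum>j<p ^ r - 1. xi j * (of_nat S * K.period S (i0 + del + t0 * j))) =
      (\<Sum>j<p ^ r - 1. (W - 1) * xi j - of_nat S * W * (if B j then xi j else 0))"
    unfolding per by (intro sum.cong refl) (simp add: algebra_simps)
  also have "\<dots> = (W - 1) * (\<Sum>j<p ^ r - 1. xi j) -
      of_nat S * W * (\<Sum>j<p ^ r - 1. if B j then xi j else 0)"
    by (simp only: sum_subtractf sum_distrib_left)
  also have "(\<Sum>j<p ^ r - 1. if B j then xi j else 0) = (\<Sum>j | j < p ^ r - 1 \<and> B j. xi j)"
    using sum.inter_filter[of "{..<p ^ r - 1}" xi B] by (simp only: finite_lessThan lessThan_iff)
  finally show ?thesis unfolding xi_def W_def B_def by (simp only: add_diff_eq)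
qed

text \<open>Turns a solution set known as one residue class into the unique existence and the
  \<open>THE\<close> form used for \<open>i0\<close> and \<open>j0\<close>.\<close>

lemma residue_class_unique:
  fixes x0 B :: nat
  assumes "x0 < B" "\<And>x. P x \<longleftrightarrow> [x = x0] (mod B)"
  shows "\<exists>!x. x < B \<and> P x" and "(THE x. x < B \<and> P x) = x0"
proof -
  have *: "x < B \<and> P x \<longleftrightarrow> x = x0" for x
  proof
    assume "x < B \<and> P x"
    thus "x = x0" using assms(2)[of x] cong_less_modulus_unique_nat[of x x0 B] assms(1) by simp
  next
    assume "x = x0"
    thus "x < B \<and> P x" using assms(1) assms(2)[of x0] by simp
  qed
  show "\<exists>!x. x < B \<and> P x" "(THE x. x < B \<and> P x) = x0" unfolding * by auto
qed

text \<open>A solution forces \<open>l\<close> to divide \<open>D\<close>, since \<open>l\<close>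
  divides both the coefficient and the modulus; then \<open>l\<close> cancels.\<close>

lemma linear_cong_reduce:
  fixes l tau u :: nat and D :: int
  assumes "l > 0"
  shows "[int (l * tau) * int j = D] (mod int (l * u)) \<longleftrightarrow>
    int l dvd D \<and> [int tau * int j = D div int l] (mod int u)"
proof (cases "int l dvd D")
  case True
  then obtain D' where D: "D = int l * D'" by (elim dvdE)
  have "[int (l * tau) * int j = D] (mod int (l * u)) \<longleftrightarrow>
      int l * int u dvd int l * (int tau * int j - D')"
    by (simp add: D cong_iff_dvd_diff algebra_simps)
  thus ?thesis using assms by (simp add: D cong_iff_dvd_diff)
next
  case False
  have "[int (l * tau) * int j = D] (mod int (l * u)) \<Longrightarrow> int l dvd D"
    using cong_dvd_modulus[of "int (l * tau) * int j" D "int (l * u)" "int l"]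
    by (metis cong_dvd_iff dvd_triv_left of_nat_mult mult.assoc)
  thus ?thesis using False by blast
qed

text \<open>Translation by \<open>1\<close> permutes the field, so comparing sums shows that
  \<open>CARD('a)\<close> is zero in it; the characteristic is therefore a prime divisor of
  \<open>p ^ k\<close>.\<close>

lemma CHAR_eqI_prime_power:
  assumes "prime p" "CARD('a::{field,finite}) = p ^ k"
  shows "CHAR('a) = p"
proof -
  have "(\<Sum>x\<in>UNIV. x + 1) = (\<Sum>x\<in>UNIV. x :: 'a)"
    by (rule sum.reindex_bij_witness[of _ "\<lambda>x. x - 1" "\<lambda>x. x + 1"]) auto
  hence "(of_nat CARD('a) :: 'a) = 0" by (simp add: sum.distrib)
  hence "CHAR('a) dvd p ^ k" by (simp only: of_nat_eq_0_iff_char_dvd assms(2))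
  hence "CHAR('a) dvd p" by (rule prime_dvd_power[OF prime_CHAR_finite_field])
  thus ?thesis using assms(1) prime_CHAR_finite_field[where 'a='a]
    by (simp add: primes_dvd_imp_eq)
qed

theorem theorem4:
  fixes p e n r q s h m t d l u t0 i0 :: nat
    and a \<gamma>m \<gamma>t g :: "'a::{field,finite}"
    and N :: real
  assumes p: "prime p"
    and e: "e \<ge> 1"
    and n: "n \<ge> 1"
    and r: "r = 2 * e * n"
    and q: "q = p ^ r"
    and s: "s > 1" "s dvd p ^ e + 1"
    and h: "h < s"
    and m: "m \<ge> 2"
    and field_card: "CARD('a) = q ^ m"
    and a: "a \<in> GFsub q"
    and t: "t dvd m"
    and d: "d = gcd (m div t) s"
    and l: "l = gcd t (s div d)"
    and u: "u = s div (d * l)"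
    and t0: "t0 = (q ^ t - 1) div (q - 1)"
    and p_ndvd: "\<not> p dvd m div t"
    and d_dvd_h: "d dvd h"
    and \<gamma>m: "primitive_element \<gamma>m"
    and \<gamma>t: "\<gamma>t = gf_norm (q ^ t) (m div t) \<gamma>m"
    and g: "g = gf_norm q m \<gamma>m"
    and i0: "i0 = (THE i. i < s div d \<and> [m div (d * t) * i = h div d] (mod s div d))"
    and N: "N = real (trace_norm_count q m t s h g a)"
  shows
    "(\<exists>!i. i < s div d \<and> [m div (d * t) * i = h div d] (mod s div d)) \<and>
     (a = 0 \<longrightarrow>
       (l > 1 \<and> \<not> [i0 = kshift p e n l t] (mod l) \<longrightarrow>
          N = real d / real s *
            (real q ^ (t - 1) - 1
             + (-1) ^ (n * t) * (real q - 1) * sqrt (real q powi (int t - 2)))) \<and>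
       (l = 1 \<or> l > 1 \<and> [i0 = kshift p e n l t] (mod l) \<longrightarrow>
          N = real d / real s *
            (real q ^ (t - 1) - 1
             - (-1) ^ (n * t) * (real q - 1) * (real l - 1) * sqrt (real q powi (int t - 2))))) \<and>
     (a \<noteq> 0 \<longrightarrow>
       (let a0 = - (of_nat (m div t) / a);
            D = int (kshift p e n (s div d) t) - int i0 - int (dlog \<gamma>t a0)
        in
          (\<not> int l dvd D \<longrightarrow>
             N = real d / real s *
               (real q ^ (t - 1) - (-1) ^ (n * t) * sqrt (real q powi (int t - 2)))) \<and>
          (int l dvd D \<longrightarrow>
             (\<exists>!j. j < u \<and> [int (t0 div l) * int j = D div int l] (mod int u)) \<and>
             (let j0 = (THE j. j < u \<and> [int (t0 div l) * int j = D div int l] (mod int u))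
              in
                (u > 1 \<and> \<not> [j0 = kshift p e n u 1] (mod u) \<longrightarrow>
                   N = real d / real s *
                     (real q ^ (t - 1)
                      - (-1) ^ (n * t) * (((-1) ^ n * sqrt (real q) - 1) * real l + 1)
                        * sqrt (real q powi (int t - 2)))) \<and>
                (u = 1 \<or> u > 1 \<and> [j0 = kshift p e n u 1] (mod u) \<longrightarrow>
                   N = real d / real s *
                     (real q ^ (t - 1)
                      - (-1) ^ (n * t)
                        * (((-1) ^ (n - 1) * (real u - 1) * sqrt (real q) - 1) * real l + 1)
                        * sqrt (real q powi (int t - 2)))))))) \<and>
     (a = 0 \<and> l = 1 \<longrightarrow> N = real d / real s * (real q ^ (t - 1) - 1)) \<and>
     (a \<noteq> 0 \<and> d = s \<longrightarrow> N = real q ^ (t - 1))"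
proof -
  define k' where "k' = m div t"
  define S where "S = s div d"
  have tpos: "t > 0" using m t by (cases "t = 0") auto
  have m_eq: "m = t * k'" using t by (simp add: k'_def)
  have k'pos: "k' > 0" using m m_eq by (cases "k' = 0") auto
  have rpos: "r > 0" using e n r by simp
  have CARD: "CARD('a) = p ^ (r * m)" by (simp only: field_card q power_mult)
  have CHAR: "p = CHAR('a)" using CHAR_eqI_prime_power[OF p CARD] by simp
  have qpos: "q > 0" using prime_gt_0_nat[OF p] by (simp add: q)
  have q1: "q > 1" unfolding q by (rule one_less_power[OF prime_gt_1_nat[OF p] rpos])
  have qt: "q ^ t = p ^ (r * t)" by (simp only: q power_mult)
  \<comment> \<open>These are \<open>(q ^ m - 1) div (q ^ t - 1)\<close> and
    \<open>(q ^ t - 1) div (q - 1)\<close>, the exponents of the two relative norms, so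
    \<open>\<gamma>t = \<gamma>m ^ E1\<close> and \<open>g = \<gamma>t ^ T0\<close>.\<close>
  define E1 where "E1 = (\<Sum>i<k'. (q ^ t) ^ i)"
  define T0 where "T0 = (\<Sum>i<t. q ^ i)"
  have E1: "(q ^ t - 1) * E1 = q ^ m - 1"
    unfolding E1_def m_eq power_mult by (rule geometric_sum_nat) (use qpos in simp)
  have T0: "(q - 1) * T0 = q ^ t - 1"
    unfolding T0_def by (rule geometric_sum_nat) (use qpos in simp)
  have t0T: "t0 = T0"
    unfolding t0 T0[symmetric] using q1 by (intro nonzero_mult_div_cancel_left) simp
  have "(q - 1) * (\<Sum>i<m. q ^ i) = (q - 1) * (T0 * E1)"
    by (subst geometric_sum_nat) (simp_all only: qpos T0 E1 mult.assoc[symmetric])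
  hence E0: "(\<Sum>i<m. q ^ i) = T0 * E1" using q1 by simp
  have qm1: "q ^ m - 1 > 0"
    using one_less_power[OF q1, of m] m by simp
  have E1pos: "E1 > 0" using E1 qm1 by (cases "E1 = 0") auto
  have T0pos: "T0 > 0" using T0 E1 qm1 by (cases "T0 = 0") auto
  have \<gamma>t_eq: "\<gamma>t = \<gamma>m ^ E1" unfolding \<gamma>t gf_norm_eq_power E1_def k'_def ..
  have g_eq: "g = \<gamma>t ^ T0"
    unfolding g gf_norm_eq_power E0 \<gamma>t_eq power_mult[symmetric] by (simp only: mult.commute)
  have order_m: "\<gamma>m ^ i = 1 \<longleftrightarrow> E1 * (q ^ t - 1) dvd i" for i
    using primitive_element_order[OF \<gamma>m, of i] by (simp only: field_card E1[symmetric] mult.commute)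
  have order_t: "\<gamma>t ^ i = 1 \<longleftrightarrow> q ^ t - 1 dvd i" for i
    unfolding \<gamma>t_eq by (rule order_power[OF order_m E1pos])
  have order_g: "g ^ i = 1 \<longleftrightarrow> q - 1 dvd i" for i
    unfolding g_eq by (rule order_power[OF _ T0pos]) (simp only: order_t T0[symmetric] mult.commute)
  interpret F: semiprimitive p r g e n
    by unfold_locales (use CHAR rpos order_g e r in \<open>simp_all add: q\<close>)
  interpret K: semiprimitive p "r * t" \<gamma>t e "n * t"
    by unfold_locales (use CHAR rpos tpos order_t e r in \<open>simp_all add: qt\<close>)
  have sS: "s = d * S" using d by (simp add: S_def)
  have dpos: "d > 0" using d s by (auto intro!: Nat.gr0I)
  have Spos: "S > 0" using sS s by (cases "S = 0") auto
  have S_dvd: "S dvd p ^ e + 1" using sS s(2) by (metis dvd_mult_right)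
  have s_dvd_q: "s dvd q - 1"
    unfolding q F.Q_minus_1 using s(2) by (metis dvd_mult dvd_mult2)
  have s_dvd_qt: "s dvd q ^ t - 1" using s_dvd_q by (metis T0 dvd_mult2)

  \<comment> \<open>Dividing by \<open>d\<close> makes the coefficient \<open>mu\<close> coprime to
    \<open>S = s div d\<close>; this gives existence and uniqueness of \<open>i0\<close>.\<close>
  define mu where "mu = k' div d"
  define h' where "h' = h div d"
  have k'_eq: "k' = d * mu" using d by (simp add: mu_def k'_def)
  have h_eq: "h = d * h'" using d_dvd_h by (simp add: h'_def)
  have mu_eq: "m div (d * t) = mu"
    by (simp only: mu_def k'_def div_mult2_eq mult.commute[of d])
  have cop: "coprime mu S"
    unfolding mu_def S_def d k'_def using s by (intro div_gcd_coprime) auto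
  obtain x0 where x0: "x0 < S" "\<And>x. [int mu * int x = int h'] (mod int S) \<longleftrightarrow> [x = x0] (mod S)"
    using cong_coprime_ex1[OF cop Spos] by blast
  have x0': "[mu * x = h'] (mod S) \<longleftrightarrow> [x = x0] (mod S)" for x
    unfolding x0(2)[symmetric] by (simp flip: cong_int_iff)
  have ex1: "\<exists>!i. i < S \<and> [mu * i = h'] (mod S)" and i0x: "i0 = x0"
    using residue_class_unique[OF x0(1) x0'] by (simp_all add: i0 mu_eq S_def h'_def)

  \<comment> \<open>The norm of \<open>\<gamma>t ^ i\<close> is \<open>g ^ (i * E1)\<close>, and
    \<open>E1\<close> is congruent to \<open>k'\<close> modulo \<open>s\<close> because each of its
    \<open>k'\<close> summands is \<open>1\<close> modulo \<open>q ^ t - 1\<close>.\<close>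
  have norm_iff: "gf_norm q m (\<gamma>t ^ i) \<in> (\<lambda>y. g ^ h * y) ` cyclic_subgroup (g ^ s) \<longleftrightarrow> [i = i0] (mod S)" for i
  proof -
    have "gf_norm q m (\<gamma>t ^ i) = g ^ (i * E1)"
      unfolding gf_norm_eq_power E0 g_eq power_mult[symmetric] by (simp only: mult_ac)
    hence "gf_norm q m (\<gamma>t ^ i) \<in> (\<lambda>y. g ^ h * y) ` cyclic_subgroup (g ^ s) \<longleftrightarrow> [i * E1 = h] (mod s)"
      using power_in_coset_iff[OF order_g _ s_dvd_q] q1 by simp
    also have "\<dots> \<longleftrightarrow> [i * k' = h] (mod s)"
    proof -
      have "[E1 = k'] (mod q ^ t - 1)" unfolding E1_def by (rule cong_geometric_sum) (use qpos in simp)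
      hence "[E1 = k'] (mod s)" by (rule cong_dvd_modulus_nat[OF _ s_dvd_qt])
      hence "[i * E1 = i * k'] (mod s)" by (rule cong_scalar_left)
      thus ?thesis by (metis cong_sym cong_trans)
    qed
    also have "\<dots> \<longleftrightarrow> [d * (mu * i) = d * h'] (mod d * S)"
      by (simp only: k'_eq h_eq sS mult_ac)
    also have "\<dots> \<longleftrightarrow> [mu * i = h'] (mod S)"
      using dpos by (simp add: cong_def mod_mult_mult1)
    finally show ?thesis unfolding x0' i0x .
  qed

  \<comment> \<open>On the field of order \<open>q ^ t\<close> the full trace is \<open>k'\<close>
    times the trace of degree \<open>t\<close>. Since \<open>p\<close> does not divide
    \<open>k'\<close>, prescribing \<open>a\<close> for the former means prescribing
    \<open>c\<close> for the latter.\<close>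
  define c where "c = a / of_nat k'"
  have k'0: "(of_nat k' :: 'a) \<noteq> 0"
    using p_ndvd by (simp add: of_nat_eq_0_iff_char_dvd k'_def CHAR[symmetric])
  have cF: "c \<in> GFsub (p ^ r)"
    unfolding c_def using a of_nat_in_GFsub[where 'a='a] by (intro GFsub_divide) (simp_all add: q CHAR)
  define X where "X = {x \<in> {\<gamma>t ^ i |i. [i = i0] (mod S)}. gf_trace (p ^ r) t x = c}"
  have trace: "gf_trace q m x = a \<longleftrightarrow> gf_trace (p ^ r) t x = c" if "x \<in> GFsub (q ^ t)" for x
  proof -
    have "gf_trace q m x = gf_trace q t (gf_trace (q ^ t) k' x)"
      using gf_trace_mult_degree[of q r k' t x] by (simp add: m_eq mult.commute q CHAR)
    also have "\<dots> = of_nat k' * gf_trace q t x"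
      unfolding gf_trace_GFsub[OF that]
      by (rule gf_trace_mult_left) (simp only: q CHAR of_nat_in_GFsub)
    finally show ?thesis using k'0 by (auto simp: c_def q field_simps)
  qed
  have "{x \<in> GFsub (q ^ t). gf_trace q m x = a \<and>
             gf_norm q m x \<in> (\<lambda>y. g ^ h * y) ` cyclic_subgroup (g ^ s)} = X"
  proof (intro equalityI subsetI)
    fix x assume x: "x \<in> {x \<in> GFsub (q ^ t). gf_trace q m x = a \<and>
             gf_norm q m x \<in> (\<lambda>y. g ^ h * y) ` cyclic_subgroup (g ^ s)}"
    \<comment> \<open>The element \<open>0\<close> has norm \<open>0\<close>, which is outside every
      coset, so all counted elements are powers of \<open>\<gamma>t\<close>.\<close>
    have "x \<noteq> 0"
    proof
      assume "x = 0"
      hence "gf_norm q m x = 0" unfolding gf_norm_eq_power E0 using T0pos E1pos by simp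
      thus False using x F.b_nonzero by (auto simp: cyclic_subgroup_def)
    qed
    moreover have "x \<in> K.L" using x by (simp flip: qt)
    ultimately obtain i where i: "x = \<gamma>t ^ i" by (metis K.L_nonzeroE)
    thus "x \<in> X" using x norm_iff[of i] trace[of x] unfolding X_def by blast
  next
    fix x assume "x \<in> X"
    then obtain i where i: "x = \<gamma>t ^ i" "[i = i0] (mod S)" "gf_trace (p ^ r) t x = c"
      unfolding X_def by blast
    moreover have "x \<in> GFsub (q ^ t)" unfolding i(1) qt by (rule K.b_in_L)
    ultimately show "x \<in> {x \<in> GFsub (q ^ t). gf_trace q m x = a \<and>
             gf_norm q m x \<in> (\<lambda>y. g ^ h * y) ` cyclic_subgroup (g ^ s)}"
      using norm_iff[of i] trace[of x] by blast
  qed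
  hence N_eq: "N = real (card X)" by (simp only: N trace_norm_count_def)

  define w where "w = real (p ^ e)"
  \<comment> \<open>The powers in the period formulas of the two fields: \<open>W\<close> is
    \<open>(- 1) ^ (n * t)\<close> times the square root of \<open>q ^ t\<close>, and
    \<open>V\<close> is \<open>(- 1) ^ n\<close> times that of \<open>q\<close>.\<close>
  define W where "W = (- w) ^ (n * t)"
  define V where "V = (- w) ^ n"
  define kk where "kk = kshift p e n S t"
  have master: "complex_of_real (real S * (real q * N)) =
      complex_of_real (real (q ^ t) - 1) +
      complex_of_real (W - 1) * (\<Sum>j<q - 1. add_char r (- (c * \<gamma>t ^ del) * g ^ j)) -
      complex_of_real (real S * W) *
        (\<Sum>j | j < q - 1 \<and> [i0 + del + T0 * j = kk] (mod S). add_char r (- (c * \<gamma>t ^ del) * g ^ j))"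
    if del: "\<gamma>t ^ del \<in> GFsub (p ^ r)" for del
  proof -
    have "complex_of_real (real (q ^ t) - 1) = of_nat (p ^ (r * t) - 1)"
      unfolding qt using K.Q_gt_1 by (simp add: of_nat_diff)
    moreover have "complex_of_real W = (- of_nat (p ^ e)) ^ (n * t)" by (simp add: W_def w_def)
    moreover have "kk = kshift p e (n * t) S 1" unfolding kk_def by (rule kshift_mult)
    ultimately show ?thesis
      using semiprimitive_trace_count[OF F.gf_subfield_axioms K.semiprimitive_axioms g_eq S_dvd cF del, of i0]
      unfolding X_def[symmetric] by (simp add: N_eq q)
  qed

  \<comment> \<open>The coefficient \<open>T0\<close> is congruent to \<open>t\<close> modulo
    \<open>q - 1\<close>, hence modulo \<open>S\<close>, so \<open>l\<close> is the gcd that governs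
    congruences with coefficient \<open>T0\<close>.\<close>
  have lS: "l = gcd T0 S"
  proof -
    have "[T0 = t] (mod q - 1)" unfolding T0_def by (rule cong_geometric_sum[OF qpos])
    hence "[T0 = t] (mod S)" by (rule cong_dvd_modulus_nat) (use sS s_dvd_q in \<open>metis dvd_mult_right\<close>)
    thus ?thesis unfolding l S_def[symmetric] by (rule cong_gcd_eq[symmetric])
  qed
  define tau where "tau = T0 div l"
  have lpos: "l > 0" using lS Spos by simp
  have Sl: "S = l * u"
    using lS by (simp add: u S_def div_mult2_eq)
  have Tl: "T0 = l * tau" using lS by (simp add: tau_def)
  have upos: "u > 0" using Sl Spos by (cases "u = 0") auto
  have cop_tau: "coprime tau u"
  proof -
    have "u = S div l" using Sl lpos by simp
    thus ?thesis unfolding tau_def lS using Spos by (simp add: div_gcd_coprime)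
  qed
  have u_dvd: "u dvd p ^ e + 1" using S_dvd Sl by (metis dvd_mult_right)
  have l_dvd: "l dvd S" using Sl by simp
  have u_dvd_q: "u dvd q - 1" using s_dvd_q sS Sl by (metis dvd_mult_right)
  define K' where "K' = (q - 1) div u"
  have qK: "q - 1 = u * K'" using u_dvd_q by (simp add: K'_def)
  have solve: "[i0 + del + T0 * j = kk] (mod S) \<longleftrightarrow>
      int l dvd int kk - int i0 - int del \<and>
      [int tau * int j = (int kk - int i0 - int del) div int l] (mod int u)" for del j
  proof -
    have "[i0 + del + T0 * j = kk] (mod S) \<longleftrightarrow>
        [int T0 * int j = int kk - int i0 - int del] (mod int S)"
      unfolding cong_int_iff[symmetric] by (simp add: cong_iff_dvd_diff algebra_simps)
    thus ?thesis unfolding Tl Sl linear_cong_reduce[OF lpos] .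
  qed

  \<comment> \<open>The integer power covers \<open>t = 1\<close>, where the exponent is
    \<open>- 1\<close>. Multiplication by \<open>q\<close> turns the root into
    \<open>w ^ (n * t)\<close>.\<close>
  define R where "R = sqrt (real q powi (int t - 2))"
  have w0: "w > 0" using prime_gt_0_nat[OF p] by (simp add: w_def)
  have qw: "real q = (w ^ n)\<^sup>2" unfolding q r w_def by (simp add: mult_ac flip: power_mult)
  have q0: "real q > 0" using qpos by simp
  have sq: "sqrt (real q) = w ^ n" unfolding qw using w0 by simp
  have R: "real q * R = w ^ (n * t)"
  proof -
    have "real q powi (int t - 2) = real q powi int t / real q powi 2"
      using q0 by (intro power_int_diff) auto
    also have "\<dots> = real q ^ t / (real q)\<^sup>2" by (simp only: power_int_of_nat power_int_numeral)
    also have "real q ^ t = (w ^ (n * t))\<^sup>2" unfolding qw power_mult[symmetric] by (simp only: mult_ac)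
    finally have "(w ^ (n * t) / real q)\<^sup>2 = real q powi (int t - 2)" by (simp only: power_divide)
    hence "R = w ^ (n * t) / real q" unfolding R_def using w0 q0 by (intro real_sqrt_unique) auto
    thus ?thesis using q0 by simp
  qed
  have W: "W = (- 1) ^ (n * t) * (real q * R)" unfolding W_def R by (rule power_minus)
  have V: "V = (- 1) ^ n * sqrt (real q)" unfolding V_def sq by (rule power_minus)
  have Qt: "real q ^ t = real q * real q ^ (t - 1)" using tpos by (cases t) auto
  have conclude: "N = real d / real s * Y" if "real S * (real q * N) = real q * Y" for Y
    using that q0 dpos Spos by (simp add: sS field_simps)

  \<comment> \<open>For \<open>c = 0\<close> all character values are \<open>1\<close>, so the
    restricted sum only counts the exceptional \<open>j\<close>: none, or one class modulo
    \<open>u\<close> with \<open>K'\<close> members.\<close>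
  have part_A: "(\<not> [i0 = kshift p e n l t] (mod l) \<longrightarrow>
        real S * (real q * N) = real (q ^ t) - 1 + (W - 1) * (real q - 1)) \<and>
      ([i0 = kshift p e n l t] (mod l) \<longrightarrow>
        real S * (real q * N) = real (q ^ t) - 1 + (W - 1) * (real q - 1) - real l * W * (real q - 1))"
    if a0: "a = 0"
  proof -
    have c0: "c = 0" by (simp add: c_def a0)
    have one: "\<gamma>t ^ 0 \<in> GFsub (p ^ r)" by (simp add: GFsub_def)
    define J where "J = {j. j < q - 1 \<and> [i0 + 0 + T0 * j = kk] (mod S)}"
    have "complex_of_real (real S * (real q * N)) =
        complex_of_real (real (q ^ t) - 1 + (W - 1) * real (q - 1) - real S * W * real (card J))"
      using master[OF one] by (simp add: c0 F.chi_0 J_def)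
    hence main: "real S * (real q * N) = real (q ^ t) - 1 + (W - 1) * (real q - 1) - real S * W * real (card J)"
      using q1 by (simp only: of_real_eq_iff) (simp add: of_nat_diff)
    have "[kk = kshift p e n l t] (mod l)"
      unfolding kk_def by (rule kshift_cong[OF p l_dvd S_dvd])
    hence cond: "[i0 = kshift p e n l t] (mod l) \<longleftrightarrow> int l dvd int kk - int i0"
      unfolding cong_iff_dvd_diff[symmetric] cong_int_iff by (metis cong_sym cong_trans)
    show ?thesis
    proof (cases "int l dvd int kk - int i0")
      case False
      hence "J = {}" unfolding J_def solve by simp
      thus ?thesis using main cond False by simp
    next
      case True
      obtain j0 where j0: "j0 < u"
        "\<And>j. [int tau * int j = (int kk - int i0) div int l] (mod int u) \<longleftrightarrow> [j = j0] (mod u)"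
        using cong_coprime_ex1[OF cop_tau upos] by blast
      have "J = {j. j < u * K' \<and> [j = j0] (mod u)}" unfolding J_def solve qK using True j0(2) by simp
      hence "card J = K'" using sum_residue_class[OF j0(1), of "\<lambda>_. 1::nat" K'] by simp
      moreover have "real u * real K' = real q - 1"
        using q1 by (simp add: of_nat_diff flip: of_nat_mult qK)
      ultimately show ?thesis using main cond True by (simp add: Sl mult_ac)
    qed
  qed

  have part_B: "(\<not> int l dvd D \<longrightarrow> real S * (real q * N) = real (q ^ t) - W) \<and>
      (int l dvd D \<longrightarrow>
        (\<exists>!j. j < u \<and> [int (t0 div l) * int j = D div int l] (mod int u)) \<and>
        real S * (real q * N) = real (q ^ t) - W - real l * W * (V - 1 -
          (if [(THE j. j < u \<and> [int (t0 div l) * int j = D div int l] (mod int u)) = kshift p e n u 1] (mod u)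
           then real u * V else 0)))"
    if a0: "a \<noteq> 0" and D: "D = int (kshift p e n (s div d) t) - int i0 -
      int (dlog \<gamma>t (- (of_nat (m div t) / a)))" for D
  proof -
    \<comment> \<open>This is \<open>- 1 / c\<close>, so with its logarithm as \<open>del\<close>
      the multiplier \<open>- (c * \<gamma>t ^ del)\<close> is \<open>1\<close>.\<close>
    define al where "al = - (of_nat k' / a)"
    define del where "del = dlog \<gamma>t al"
    have D': "D = int kk - int i0 - int del"
      by (simp only: D kk_def S_def del_def al_def k'_def)
    have alF: "al \<in> F.L"
    proof -
      have "of_nat k' / a \<in> F.L"
        using a of_nat_in_GFsub[where 'a='a] by (intro GFsub_divide) (simp_all add: q CHAR)
      thus ?thesis unfolding al_def CHAR by (rule GFsub_uminus)
    qed
    have al0: "al \<noteq> 0" using a0 k'0 by (simp add: al_def)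
    have "al \<in> K.L" using alF GFsub_power_subset[of "p ^ r" t] by (auto simp: power_mult)
    then obtain i where "\<gamma>t ^ i = al" using al0 by (metis K.L_nonzeroE)
    hence del: "\<gamma>t ^ del = al" unfolding del_def dlog_def by (rule LeastI)
    have cal: "- (c * \<gamma>t ^ del) * y = y" for y
      unfolding del using a0 k'0 by (simp add: c_def al_def)
    have sum: "(\<Sum>j<q - 1. F.chi (g ^ j)) = - 1"
      using F.sum_chi unfolding F.sum_L F.chi_0 q by (simp add: add_eq_0_iff)
    define P where "P = (\<Sum>j | j < q - 1 \<and> [i0 + del + T0 * j = kk] (mod S). F.chi (g ^ j))"
    have main: "complex_of_real (real S * (real q * N)) =
        complex_of_real (real (q ^ t) - W) - complex_of_real (real S * W) * P"
      using master[of del] alF unfolding del[symmetric] cal sum P_def[symmetric] by simp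
    show ?thesis
    proof (cases "int l dvd D")
      case False
      hence "P = 0" unfolding P_def solve D' by simp
      hence "complex_of_real (real S * (real q * N)) = complex_of_real (real (q ^ t) - W)"
        using main by simp
      thus ?thesis using False by (simp only: of_real_eq_iff) simp
    next
      case True
      obtain j0 where j0: "j0 < u"
        "\<And>j. [int tau * int j = D div int l] (mod int u) \<longleftrightarrow> [j = j0] (mod u)"
        using cong_coprime_ex1[OF cop_tau upos] by blast
      have tau: "t0 div l = tau" by (simp only: t0T tau_def)
      note uniq = residue_class_unique[OF j0]
      \<comment> \<open>The exceptional \<open>j\<close> form one class modulo \<open>u\<close>, so
        the restricted sum is a Gaussian period of order \<open>u\<close> of the small field, and
        \<open>u\<close> again divides \<open>p ^ e + 1\<close>.\<close>
      have "P = (\<Sum>j | j < u * K' \<and> [j = j0] (mod u). F.chi (g ^ j))"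
        unfolding P_def solve qK using True j0(2) by (simp add: D')
      also have "\<dots> = F.period u j0"
        unfolding sum_residue_class[OF j0(1)] F.period_def K'_def q ..
      finally have "of_nat u * P = complex_of_real (V - 1 -
          (if [j0 = kshift p e n u 1] (mod u) then real u * V else 0))"
        using F.period_eq[OF u_dvd, of j0] by (simp add: V_def w_def)
      moreover have "complex_of_real (real S * W) * P = complex_of_real (real l * W) * (of_nat u * P)"
        by (simp only: Sl of_nat_mult of_real_mult of_real_of_nat_eq mult_ac)
      ultimately have "complex_of_real (real S * W) * P = complex_of_real (real l * W * (V - 1 -
          (if [j0 = kshift p e n u 1] (mod u) then real u * V else 0)))"
        by (simp only: of_real_mult)
      hence "complex_of_real (real S * (real q * N)) = complex_of_real (real (q ^ t) - W -
          real l * W * (V - 1 - (if [j0 = kshift p e n u 1] (mod u) then real u * V else 0)))"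
        using main by (simp only: of_real_diff)
      hence "real S * (real q * N) = real (q ^ t) - W -
          real l * W * (V - 1 - (if [j0 = kshift p e n u 1] (mod u) then real u * V else 0))"
        by (simp only: of_real_eq_iff)
      thus ?thesis using True uniq unfolding tau by simp
    qed
  qed
  define D where "D = int (kshift p e n (s div d) t) - int i0 -
    int (dlog \<gamma>t (- (of_nat (m div t) / a)))"
  define j0 where "j0 = (THE j. j < u \<and> [int (t0 div l) * int j = D div int l] (mod int u))"
  have i0_ex1: "\<exists>!i. i < s div d \<and> [m div (d * t) * i = h div d] (mod s div d)"
    unfolding mu_eq S_def[symmetric] h'_def[symmetric] by (rule ex1)
  have caseA: "N = real d / real s * (real q ^ (t - 1) - 1 + (-1) ^ (n * t) * (real q - 1) * R)"
    if "a = 0" "\<not> [i0 = kshift p e n l t] (mod l)"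
    using part_A[OF that(1)] that(2) by (intro conclude) (simp add: Qt W algebra_simps)
  have caseA': "N = real d / real s *
      (real q ^ (t - 1) - 1 - (-1) ^ (n * t) * (real q - 1) * (real l - 1) * R)"
    if "a = 0" "[i0 = kshift p e n l t] (mod l)"
    using part_A[OF that(1)] that(2) by (intro conclude) (simp add: Qt W algebra_simps)
  note B = part_B[OF _ D_def, folded j0_def]
  have caseB: "N = real d / real s * (real q ^ (t - 1) - (-1) ^ (n * t) * R)"
    if "a \<noteq> 0" "\<not> int l dvd D"
    using B[OF that(1)] that(2) by (intro conclude) (simp add: Qt W algebra_simps)
  have caseB1: "N = real d / real s * (real q ^ (t - 1) -
      (-1) ^ (n * t) * (((-1) ^ n * sqrt (real q) - 1) * real l + 1) * R)"
    if "a \<noteq> 0" "int l dvd D" "\<not> [j0 = kshift p e n u 1] (mod u)"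
    using B[OF that(1)] that(2,3) by (intro conclude) (simp add: Qt W V algebra_simps)
  \<comment> \<open>As \<open>n\<close> is positive, \<open>(- 1) ^ (n - 1)\<close> is the negative
    of \<open>(- 1) ^ n\<close>, which is the sign in \<open>V\<close>.\<close>
  have V': "(-1) ^ (n - 1) * (real u - 1) * sqrt (real q) = - ((real u - 1) * V)"
    using n by (cases n) (simp_all add: V)
  have caseB2: "N = real d / real s * (real q ^ (t - 1) -
      (-1) ^ (n * t) * (((-1) ^ (n - 1) * (real u - 1) * sqrt (real q) - 1) * real l + 1) * R)"
    if "a \<noteq> 0" "int l dvd D" "[j0 = kshift p e n u 1] (mod u)"
    unfolding V'
    using B[OF that(1)] that(2,3) by (intro conclude) (simp add: Qt W algebra_simps)
  have j0_ex1: "\<exists>!j. j < u \<and> [int (t0 div l) * int j = D div int l] (mod int u)"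
    if "a \<noteq> 0" "int l dvd D"
    using B[OF that(1)] that(2) by blast
  \<comment> \<open>Modulo \<open>1\<close> the congruence always holds, which is why
    \<open>l = 1\<close> and \<open>u = 1\<close> join the congruent cases of the statement.\<close>
  have l1: "[i0 = kshift p e n l t] (mod l)" if "l = 1" using that by (simp add: cong_def)
  have u1: "[j0 = kshift p e n u 1] (mod u)" if "u = 1" using that by (simp add: cong_def)
  have special0: "N = real d / real s * (real q ^ (t - 1) - 1)" if "a = 0" "l = 1"
    using caseA'[OF that(1) l1[OF that(2)]] that(2) by simp
  have special1: "N = real q ^ (t - 1)" if "a \<noteq> 0" "d = s"
  proof -
    \<comment> \<open>Then also \<open>l = u = 1\<close>, so \<open>l\<close> divides
      \<open>D\<close> and the factor multiplying the square root is \<open>0\<close>.\<close>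
    have "S = 1" using that(2) s by (simp add: S_def)
    hence "l = 1" "u = 1" using Sl by simp_all
    with caseB2[OF that(1) _ u1] show ?thesis using that(2) s by simp
  qed
  show ?thesis
    unfolding Let_def D_def[symmetric] j0_def[symmetric] R_def[symmetric]
    using i0_ex1 caseA caseA' caseB caseB1 caseB2 j0_ex1 l1 u1 special0 special1 by blast
qed

end
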